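(* Let $(H,e)$ be a unital Hilbert space, let $\mathfrak B^e_h$ be the quantum set with $\mathfrak B^e_h\cap M_m(H)=\{\eta\in M_m(H)_h:\langle\langle\eta,\bar e\rangle\rangle=0,\ \|\eta\|_o\le1\}$, and define quantum cones $\mathfrak C_o$ on $H$ and $\overline{\mathfrak C_o}$ on $\overline H$ by $\mathfrak C_o\cap M_n(H)=\{\zeta\in M_n(H)_h:\langle\langle\zeta,\bar\eta+\bar e^{(m)}\rangle\rangle\ge0\ \forall m,\ \forall\eta\in\mathfrak B^e_h\cap M_m(H)\}$, $\overline{\mathfrak C_o}\cap M_n(\overline H)=\{\bar\xi\in M_n(\overline H)_h:\langle\langle\eta+e^{(m)},\bar\xi\rangle\rangle\ge0\ \forall m,\ \forall\eta\in\mathfrak B^e_h\cap M_m(H)\}$. Then $\mathfrak C_o$ is a separated, unital quantum cone on $H$ with $\mathfrak C_o\cap M_1(H)=\mathfrak c_e$, so that $(H,(\mathfrak C_o\cap M_n(H))_n,e)$ is an operator system (Archimedean matrix-ordered $*$-vector space with matrix order unit $e$); its order-unit matrix norm equals $\|\cdot\|_e$ of Lemma lBP2 and is therefore equivalent to the operator Hilbert space norm $\|\cdot\|_o$. Its matricial state space $\{\bar\xi\in\mathfrak C_o^\boxdot:\langle\langle e,\bar\xi\rangle\rangle=I\}$ equals $\{\bar\eta+\bar e^{(n)}:\eta\in\mathfrak B^e_h\cap M_n(H),\ n\ge1\}$. Moreover $H_o$ is self-dual: $\mathfrak C_o^\boxdot=\overline{\mathfrak C_o}$ and $\overline{\mathfrak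 C_o}^\boxdot=\mathfrak C_o$.
   Context: A Hilbert $*$-space is a complex Hilbert space $H$ (inner product linear in the first variable) with a conjugate-linear $\zeta\mapsto\zeta^*$, $\zeta^{**}=\zeta$, $(\zeta^*,\eta^* )=\overline{(\zeta,\eta)}$. A unital Hilbert space $(H,e)$ has a fixed hermitian unit vector $e$; its unital cone is $\mathfrak c_e=\{\zeta\in H_h:\|\zeta\|\le\sqrt2(\zeta,e)\}$. $\overline H$ is the conjugate Hilbert space (vectors $\bar\eta$, involution $\bar\eta^*=\overline{\eta^*}$). Matrices over $H$ or $\overline H$ carry the involution $[x_{ij}]^*=[x_{ji}^*]$; for $\eta=[\eta_{ij}]$, $\bar\eta=[\overline{\eta_{ij}}]$; $e^{(m)}=\mathrm{diag}(e,\ldots,e)$. Matrix pairing: $\langle\langle\zeta,\bar\eta\rangle\rangle=[(\zeta_{ik},\eta_{jl})]_{(i,j),(k,l)}\in M_{nm}$ for $\zeta\in M_n(H)$, $\eta\in M_m(H)$; $\langle\langle\eta,\bar e\rangle\rangle=[(\eta_{ij},e)]$. $\|\zeta\|_o=\|\langle\langle\zeta,\bar\zeta\rangle\rangle\|^{1/2}$ is the operator Hilbert space matrix norm. Quantum polar: for a family $\mathfrak M$ of matrices over $H$, $\mathfrak M^\boxdot=\{\bar\xi\in M_n(\overline H)_h:\langle\langle\zeta,\bar\xi\rangle\rangle\ge0\ \forall\zeta\in\mathfrak M\}$, and symmetrically for families over $\overline H$. A quantum cone $\mathfrak C=(\mathfrak C_n)$: $\mathfrak C_n\subseteq M_n(H)_h$,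 $\mathfrak C_n+\mathfrak C_n\subseteq\mathfrak C_n$, $a^*\mathfrak C_na\subseteq\mathfrak C_m$ for $a\in M_{n,m}$; separated: $\mathfrak C_n\cap-\mathfrak C_n=\{0\}$; unital: for each $x\in M_n(H)_h$ some $x+re^{(n)}\in\mathfrak C_n$, $r>0$. Lemma lBP2: $\|\zeta\|_e=\sup\{\|\langle\langle\zeta,\bar\eta+\bar e^{(m)}\rangle\rangle\|:\eta\in\mathfrak B^e_h\cap M_m(H)\}$ satisfies $\frac12\|\zeta\|_e\le\|\zeta\|_o\le10\|\zeta\|_e$. *)

theory Defs
  imports Complex_Main "HOL-Library.Complex_Order"
begin

text \<open>A complex Hilbert space is modelled as an abelian group 'h with a complex scalar
 multiplication sm (the vector space axioms are part of hilbert_star_space) together with an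
 inner product ip (linear in the first variable) that is complete for the induced norm.
 The involution is st.  (Main has no class of complex vector spaces.)\<close>

definition complex_vs :: "(complex \<Rightarrow> 'h::ab_group_add \<Rightarrow> 'h) \<Rightarrow> bool" where
  "complex_vs sm \<longleftrightarrow> (\<forall>a x y. sm a (x + y) = sm a x + sm a y) \<and>
     (\<forall>a b x. sm (a + b) x = sm a x + sm b x) \<and>
     (\<forall>a b x. sm (a * b) x = sm a (sm b x)) \<and> (\<forall>x. sm 1 x = x)"

definition hnorm :: "('h \<Rightarrow> 'h \<Rightarrow> complex) \<Rightarrow> 'h \<Rightarrow> real" where
  "hnorm ip x = sqrt (Re (ip x x))"

definition hilbert_star_space :: "(complex \<Rightarrow> 'h \<Rightarrow> 'h) \<Rightarrow>
  ('h::ab_group_add \<Rightarrow> 'h \<Rightarrow> complex) \<Rightarrow> ('h \<Rightarrow> 'h) \<Rightarrow> bool" where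
  "hilbert_star_space sm ip st \<longleftrightarrow> complex_vs sm \<and>
     (\<forall>x y z. ip (x + y) z = ip x z + ip y z) \<and>
     (\<forall>c x y. ip (sm c x) y = c * ip x y) \<and>
     (\<forall>x y. ip x y = cnj (ip y x)) \<and>
     (\<forall>x. 0 \<le> ip x x) \<and>
     (\<forall>x. ip x x = 0 \<longrightarrow> x = 0) \<and>
     (\<forall>X :: nat \<Rightarrow> 'h. (\<forall>\<epsilon>>0. \<exists>N. \<forall>m\<ge>N. \<forall>n\<ge>N. hnorm ip (X m - X n) < \<epsilon>) \<longrightarrow>
        (\<exists>L. \<forall>\<epsilon>>0. \<exists>N. \<forall>n\<ge>N. hnorm ip (X n - L) < \<epsilon>)) \<and>
     (\<forall>x y. st (x + y) = st x + st y) \<and>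
     (\<forall>c x. st (sm c x) = sm (cnj c) (st x)) \<and>
     (\<forall>x. st (st x) = x) \<and>
     (\<forall>x y. ip (st x) (st y) = cnj (ip x y))"

definition unital_hilbert_space :: "(complex \<Rightarrow> 'h \<Rightarrow> 'h) \<Rightarrow>
  ('h::ab_group_add \<Rightarrow> 'h \<Rightarrow> complex) \<Rightarrow> ('h \<Rightarrow> 'h) \<Rightarrow> 'h \<Rightarrow> bool" where
  "unital_hilbert_space sm ip st e \<longleftrightarrow> hilbert_star_space sm ip st \<and> st e = e \<and> hnorm ip e = 1"

definition unital_cone ::
  "('h \<Rightarrow> 'h \<Rightarrow> complex) \<Rightarrow> ('h \<Rightarrow> 'h) \<Rightarrow> 'h \<Rightarrow> 'h set" where
  "unital_cone ip st e = {z. st z = z \<and> complex_of_real (hnorm ip z) \<le> complex_of_real (sqrt 2) * ip z e}"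

text \<open>An n x n matrix over H is a function nat => nat => 'h vanishing outside {..<n} x {..<n}.
 A matrix over the conjugate space, [bar xi_ij], is represented by the underlying matrix xi
 over H; it is hermitian in M_n(conj H) iff xi is hermitian in M_n(H).\<close>

type_synonym 'h hmat = "nat \<Rightarrow> nat \<Rightarrow> 'h"

definition in_mat :: "nat \<Rightarrow> 'h::zero hmat \<Rightarrow> bool" where
  "in_mat n x \<longleftrightarrow> (\<forall>i j. (n \<le> i \<or> n \<le> j) \<longrightarrow> x i j = 0)"

definition madj :: "('h \<Rightarrow> 'h) \<Rightarrow> 'h hmat \<Rightarrow> 'h hmat" where
  "madj st x = (\<lambda>i j. st (x j i))"

definition herm :: "('h::zero \<Rightarrow> 'h) \<Rightarrow> nat \<Rightarrow> 'h hmat \<Rightarrow> bool" where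
  "herm st n x \<longleftrightarrow> in_mat n x \<and> madj st x = x"

definition madd :: "'h::plus hmat \<Rightarrow> 'h hmat \<Rightarrow> 'h hmat" where
  "madd x y = (\<lambda>i j. x i j + y i j)"

definition mscale :: "(complex \<Rightarrow> 'h \<Rightarrow> 'h) \<Rightarrow> real \<Rightarrow> 'h hmat \<Rightarrow> 'h hmat" where
  "mscale sm r x = (\<lambda>i j. sm (complex_of_real r) (x i j))"

definition emat :: "'h::zero \<Rightarrow> nat \<Rightarrow> 'h hmat" where
  "emat e n = (\<lambda>i j. if i = j \<and> i < n then e else 0)"

definition congr :: "(complex \<Rightarrow> 'h \<Rightarrow> 'h) \<Rightarrow> nat \<Rightarrow> nat \<Rightarrow> (nat \<Rightarrow> nat \<Rightarrow> complex) \<Rightarrow> 'h::comm_monoid_add hmat \<Rightarrow> 'h hmat" where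
  "congr sm n m a x = (\<lambda>k l. if k < m \<and> l < m then
       (\<Sum>i<n. \<Sum>j<n. sm (cnj (a i k) * a j l) (x i j)) else 0)"

definition block2 :: "nat \<Rightarrow> 'h::zero hmat \<Rightarrow> 'h hmat \<Rightarrow> 'h hmat \<Rightarrow> 'h hmat \<Rightarrow> 'h hmat" where
  "block2 n A B C D = (\<lambda>i j.
     if i < n \<and> j < n then A i j
     else if i < n \<and> n \<le> j \<and> j < 2*n then B i (j - n)
     else if n \<le> i \<and> i < 2*n \<and> j < n then C (i - n) j
     else if n \<le> i \<and> i < 2*n \<and> n \<le> j \<and> j < 2*n then D (i - n) (j - n)
     else 0)"

definition cpos :: "'i set \<Rightarrow> ('i \<Rightarrow> 'i \<Rightarrow> complex) \<Rightarrow> bool" where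
  "cpos I A \<longleftrightarrow> (\<forall>v. 0 \<le> (\<Sum>p\<in>I. \<Sum>q\<in>I. cnj (v p) * A p q * v q))"

definition copnorm :: "'i set \<Rightarrow> ('i \<Rightarrow> 'i \<Rightarrow> complex) \<Rightarrow> real" where
  "copnorm I A = Sup {sqrt (\<Sum>p\<in>I. (cmod (\<Sum>q\<in>I. A p q * v q))\<^sup>2) | v.
                         (\<Sum>q\<in>I. (cmod (v q))\<^sup>2) \<le> 1}"

definition cmat_id :: "'i set \<Rightarrow> 'i \<Rightarrow> 'i \<Rightarrow> complex" where
  "cmat_id I = (\<lambda>p q. if p = q \<and> p \<in> I then 1 else 0)"

definition mpair :: "('h \<Rightarrow> 'h \<Rightarrow> complex) \<Rightarrow> nat \<Rightarrow> nat \<Rightarrow> 'h hmat \<Rightarrow> 'h hmat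
     \<Rightarrow> nat \<times> nat \<Rightarrow> nat \<times> nat \<Rightarrow> complex" where
  "mpair ip n m z y = (\<lambda>(i, j) (k, l).
      if i < n \<and> k < n \<and> j < m \<and> l < m then ip (z i k) (y j l) else 0)"

definition idx :: "nat \<Rightarrow> nat \<Rightarrow> (nat \<times> nat) set" where
  "idx n m = {..<n} \<times> {..<m}"

definition onorm :: "('h \<Rightarrow> 'h \<Rightarrow> complex) \<Rightarrow> nat \<Rightarrow> 'h hmat \<Rightarrow> real" where
  "onorm ip n z = sqrt (copnorm (idx n n) (mpair ip n n z z))"

text \<open>Polar of a family over H: a family over conj H.\<close>
definition polarH :: "('h \<Rightarrow> 'h \<Rightarrow> complex) \<Rightarrow> ('h::zero \<Rightarrow> 'h)
     \<Rightarrow> (nat \<Rightarrow> 'h hmat set) \<Rightarrow> nat \<Rightarrow> 'h hmat set" where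
  "polarH ip st M n = {x. herm st n x \<and> (\<forall>m. \<forall>z\<in>M m. cpos (idx m n) (mpair ip m n z x))}"

text \<open>Polar of a family over conj H: a family over H.\<close>
definition polarHbar :: "('h \<Rightarrow> 'h \<Rightarrow> complex) \<Rightarrow> ('h::zero \<Rightarrow> 'h)
     \<Rightarrow> (nat \<Rightarrow> 'h hmat set) \<Rightarrow> nat \<Rightarrow> 'h hmat set" where
  "polarHbar ip st N n = {z. herm st n z \<and> (\<forall>m. \<forall>x\<in>N m. cpos (idx n m) (mpair ip n m z x))}"

definition quantum_cone :: "(complex \<Rightarrow> 'h \<Rightarrow> 'h) \<Rightarrow> ('h::ab_group_add \<Rightarrow> 'h) \<Rightarrow> (nat \<Rightarrow> 'h hmat set) \<Rightarrow> bool" where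
  "quantum_cone sm st C \<longleftrightarrow>
     (\<forall>n. C n \<subseteq> {x. herm st n x}) \<and>
     (\<forall>n x y. x \<in> C n \<longrightarrow> y \<in> C n \<longrightarrow> madd x y \<in> C n) \<and>
     (\<forall>n m a x. x \<in> C n \<longrightarrow> congr sm n m a x \<in> C m)"

definition separated_cone :: "(nat \<Rightarrow> 'h::ab_group_add hmat set) \<Rightarrow> bool" where
  "separated_cone C \<longleftrightarrow> (\<forall>n. C n \<inter> {x. (\<lambda>i j. - x i j) \<in> C n} = {\<lambda>i j. 0})"

definition unital_qcone :: "(complex \<Rightarrow> 'h \<Rightarrow> 'h) \<Rightarrow> ('h::ab_group_add \<Rightarrow> 'h) \<Rightarrow> 'h \<Rightarrow> (nat \<Rightarrow> 'h hmat set) \<Rightarrow> bool" where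
  "unital_qcone sm st e C \<longleftrightarrow>
     (\<forall>n x. herm st n x \<longrightarrow> (\<exists>r>0. madd x (mscale sm r (emat e n)) \<in> C n))"

definition archimedean_qcone :: "(complex \<Rightarrow> 'h \<Rightarrow> 'h) \<Rightarrow> ('h::ab_group_add \<Rightarrow> 'h) \<Rightarrow> 'h \<Rightarrow> (nat \<Rightarrow> 'h hmat set) \<Rightarrow> bool" where
  "archimedean_qcone sm st e C \<longleftrightarrow>
     (\<forall>n x. herm st n x \<longrightarrow> (\<forall>r>0. madd x (mscale sm r (emat e n)) \<in> C n) \<longrightarrow> x \<in> C n)"

definition operator_system :: "(complex \<Rightarrow> 'h \<Rightarrow> 'h) \<Rightarrow> ('h::ab_group_add \<Rightarrow> 'h) \<Rightarrow> 'h \<Rightarrow> (nat \<Rightarrow> 'h hmat set) \<Rightarrow> bool" where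
  "operator_system sm st e C \<longleftrightarrow> st e = e \<and> quantum_cone sm st C \<and> separated_cone C \<and>
     unital_qcone sm st e C \<and> archimedean_qcone sm st e C"

definition ou_norm :: "(complex \<Rightarrow> 'h \<Rightarrow> 'h) \<Rightarrow> ('h::ab_group_add \<Rightarrow> 'h) \<Rightarrow> 'h \<Rightarrow> (nat \<Rightarrow> 'h hmat set) \<Rightarrow> nat \<Rightarrow> 'h hmat \<Rightarrow> real" where
  "ou_norm sm st e C n x = Inf {r. 0 < r \<and>
     block2 n (mscale sm r (emat e n)) x (madj st x) (mscale sm r (emat e n)) \<in> C (2*n)}"

definition Bset :: "('h \<Rightarrow> 'h \<Rightarrow> complex) \<Rightarrow> ('h::ab_group_add \<Rightarrow> 'h) \<Rightarrow> 'h \<Rightarrow> nat \<Rightarrow> 'h hmat set" where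
  "Bset ip st e m = {y. herm st m y \<and> (\<forall>i j. ip (y i j) e = 0) \<and> onorm ip m y \<le> 1}"

definition Co :: "('h \<Rightarrow> 'h \<Rightarrow> complex) \<Rightarrow> ('h::ab_group_add \<Rightarrow> 'h) \<Rightarrow> 'h \<Rightarrow> nat \<Rightarrow> 'h hmat set" where
  "Co ip st e n = {z. herm st n z \<and>
     (\<forall>m. \<forall>y\<in>Bset ip st e m. cpos (idx n m) (mpair ip n m z (madd y (emat e m))))}"

definition Cobar :: "('h \<Rightarrow> 'h \<Rightarrow> complex) \<Rightarrow> ('h::ab_group_add \<Rightarrow> 'h) \<Rightarrow> 'h \<Rightarrow> nat \<Rightarrow> 'h hmat set" where
  "Cobar ip st e n = {x. herm st n x \<and>
     (\<forall>m. \<forall>y\<in>Bset ip st e m. cpos (idx m n) (mpair ip m n (madd y (emat e m)) x))}"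

definition e_norm :: "('h \<Rightarrow> 'h \<Rightarrow> complex) \<Rightarrow> ('h::ab_group_add \<Rightarrow> 'h) \<Rightarrow> 'h \<Rightarrow> nat \<Rightarrow> 'h hmat \<Rightarrow> real" where
  "e_norm ip st e n z = Sup {copnorm (idx n m) (mpair ip n m z (madd y (emat e m))) | m y.
       y \<in> Bset ip st e m}"

end

theory Submission
  imports Defs "Jordan_Normal_Form.Spectral_Radius" "HOL-Analysis.L2_Norm"
begin

text \<open>The key inequality is the Cauchy--Schwarz inequality
  \<open>\<parallel>\<langle>\<langle>x, y\<rangle>\<rangle>\<parallel> \<le> \<parallel>x\<parallel>\<^sub>o \<parallel>y\<parallel>\<^sub>o\<close> for the matrix pairing. Viewing the test vectors as
  matrices and factoring each of them through its absolute value reduces it to the ordinary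
  Cauchy--Schwarz inequality in \<open>H\<close>. Matrices over the conjugate space are represented by the
  underlying matrices over \<open>H\<close>, so exchanging the two arguments of the pairing only conjugates
  it, and the two cones coincide as sets. After adding \<open>\<epsilon> e\<close> every element of the cone is
  congruent to some \<open>y + e\<close> with \<open>y\<close> in the hermitian unit ball orthogonal to \<open>e\<close>; together
  with \<open>\<langle>\<langle>y, y'\<rangle>\<rangle> \<ge> -1\<close> on that ball, this gives self-duality.\<close>

section \<open>Spectral theorem for hermitian matrices\<close>

text \<open>Cauchy-Schwarz applied entry by entry would bound the pairing by sums of squared
  entries, and these are not controlled by \<open>onorm\<close> independently of the matrix size.
  After the factorization, the sums of squares that occur are themselves values of
  \<open><<x, x>>\<close> and \<open><<y, y>>\<close>, and the absolute value balances the two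
  factors so that no constant is lost. The constant 1 matters: any larger one would destroy the
  lower bound -1 on the unit ball, and with it self-duality. The perturbation by \<epsilon> is
  forced because the \<open>e\<close>-component of a cone element is only positive semidefinite and
  may have no inverse square root; a limit removes it at the end. For the comparison of norms, the
  cone tests a matrix only against \<open>y + e\<close> with \<open>y\<close> hermitian and
  orthogonal to \<open>e\<close>, while \<open>onorm\<close> tests it against itself. Splitting the
  matrix into pieces of the admissible kind yields a quadratic inequality for \<open>onorm\<close>,
  from which the numerical constant comes.\<close>

definition fmult :: "nat \<Rightarrow> (nat \<Rightarrow> nat \<Rightarrow> complex) \<Rightarrow> (nat \<Rightarrow> nat \<Rightarrow> complex) \<Rightarrow> nat \<Rightarrow> nat \<Rightarrow> complex" where
  "fmult n A B = (\<lambda>i j. \<Sum>k<n. A i k * B k j)"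

definition fadj :: "(nat \<Rightarrow> nat \<Rightarrow> complex) \<Rightarrow> nat \<Rightarrow> nat \<Rightarrow> complex" where
  "fadj A = (\<lambda>i j. cnj (A j i))"

definition fdiag :: "(nat \<Rightarrow> complex) \<Rightarrow> nat \<Rightarrow> nat \<Rightarrow> complex" where
  "fdiag d = (\<lambda>i j. if i = j then d i else 0)"

text \<open>Products sum over \<open>k < n\<close> but are functions of all indices, so values
  outside the n by n corner are arbitrary. Matrix identities therefore hold only modulo this
  relation, except for associativity and adjoints, which are genuine equations.\<close>

definition fm_eq :: "nat \<Rightarrow> (nat \<Rightarrow> nat \<Rightarrow> complex) \<Rightarrow> (nat \<Rightarrow> nat \<Rightarrow> complex) \<Rightarrow> bool" where
  "fm_eq n A B \<longleftrightarrow> (\<forall>i<n. \<forall>j<n. A i j = B i j)"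

definition funitary :: "nat \<Rightarrow> (nat \<Rightarrow> nat \<Rightarrow> complex) \<Rightarrow> bool" where
  "funitary n W \<longleftrightarrow> fm_eq n (fmult n (fadj W) W) (fdiag (\<lambda>_. 1))
     \<and> fm_eq n (fmult n W (fadj W)) (fdiag (\<lambda>_. 1))"

lemma fmult_assoc: "fmult n (fmult n A B) C = fmult n A (fmult n B C)"
proof (intro ext)
  fix i j
  have "fmult n (fmult n A B) C i j = (\<Sum>k<n. \<Sum>l<n. A i l * B l k * C k j)"
    by (simp add: fmult_def sum_distrib_right)
  also have "\<dots> = (\<Sum>l<n. \<Sum>k<n. A i l * B l k * C k j)" by (rule sum.swap)
  finally show "fmult n (fmult n A B) C i j = fmult n A (fmult n B C) i j"
    by (simp add: fmult_def sum_distrib_left mult.assoc)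
qed

lemma fadj_fmult: "fadj (fmult n A B) = fmult n (fadj B) (fadj A)"
  by (simp add: fadj_def fmult_def fun_eq_iff mult.commute)

lemma fadj_fadj [simp]: "fadj (fadj A) = A"
  by (simp add: fadj_def)

lemma fm_eq_refl [simp]: "fm_eq n A A"
  and fm_eq_sym: "fm_eq n A B \<Longrightarrow> fm_eq n B A"
  and fm_eq_trans [trans]: "fm_eq n A B \<Longrightarrow> fm_eq n B C \<Longrightarrow> fm_eq n A C"
  by (auto simp: fm_eq_def)

lemma fm_eq_fmult: "fm_eq n A A' \<Longrightarrow> fm_eq n B B' \<Longrightarrow> fm_eq n (fmult n A B) (fmult n A' B')"
  by (simp add: fm_eq_def fmult_def)

lemma fmult_one: "fm_eq n (fmult n (fdiag (\<lambda>_. 1)) A) A" "fm_eq n (fmult n A (fdiag (\<lambda>_. 1))) A"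
  by (auto simp: fm_eq_def fmult_def fdiag_def if_distrib[of "\<lambda>x. x * _"] if_distrib[of "\<lambda>x. _ * x"]
      cong: if_cong)

lemma fmult_cancel:
  assumes "fm_eq n (fmult n A B) (fdiag (\<lambda>_. 1))"
  shows "fm_eq n (fmult n A (fmult n B C)) C"
  by (metis assms fm_eq_fmult fm_eq_refl fm_eq_trans fmult_assoc fmult_one(1))

lemma funitary_fmult:
  assumes "funitary n Q" "funitary n W"
  shows "funitary n (fmult n Q W)"
proof -
  have "fm_eq n (fmult n (fadj W) (fmult n (fadj Q) (fmult n Q W))) (fmult n (fadj W) W)"
    by (intro fm_eq_fmult fm_eq_refl fmult_cancel) (use assms in \<open>auto simp: funitary_def\<close>)
  moreover have "fm_eq n (fmult n Q (fmult n W (fmult n (fadj W) (fadj Q)))) (fmult n Q (fadj Q))"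
    by (intro fm_eq_fmult fm_eq_refl fmult_cancel) (use assms in \<open>auto simp: funitary_def\<close>)
  ultimately show ?thesis
    using assms by (auto simp: funitary_def fadj_fmult fmult_assoc intro: fm_eq_trans)
qed

text \<open>Over the complex numbers the spectrum of a nonempty square matrix is nonempty. An
  eigenvector may be multiplied by any phase, which makes its last coordinate real and nonpositive,
  as the reflection below requires.\<close>

lemma unit_eigenvector_exists:
  fixes A :: "nat \<Rightarrow> nat \<Rightarrow> complex"
  shows "\<exists>v \<mu>. (\<Sum>i<Suc n. (cmod (v i))\<^sup>2) = 1 \<and> (\<forall>i<Suc n. (\<Sum>j<Suc n. A i j * v j) = \<mu> * v i)
    \<and> v n = - complex_of_real (cmod (v n))"
proof -
  let ?A = "mat (Suc n) (Suc n) (\<lambda>(i, j). A i j)"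
  have "spectrum ?A \<noteq> {}"
    by (rule spectrum_non_empty[of _ "Suc n"]) auto
  then obtain \<mu> w where w: "w \<in> carrier_vec (Suc n)" "w \<noteq> 0\<^sub>v (Suc n)" "?A *\<^sub>v w = \<mu> \<cdot>\<^sub>v w"
    by (auto simp: spectrum_def eigenvalue_def eigenvector_def)
  have ev: "(\<Sum>j<Suc n. A i j * w $ j) = \<mu> * w $ i" if "i < Suc n" for i
  proof -
    have "(?A *\<^sub>v w) $ i = (\<mu> \<cdot>\<^sub>v w) $ i" by (simp add: w)
    then show ?thesis
      using that w(1) by (simp add: scalar_prod_def atLeast0LessThan)
  qed
  define s where "s = (\<Sum>i<Suc n. (cmod (w $ i))\<^sup>2)"
  obtain i where i: "i < Suc n" "w $ i \<noteq> 0"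
    using w(1,2) by (metis carrier_vecD eq_vecI index_zero_vec(1,2))
  then have "0 < (cmod (w $ i))\<^sup>2" by simp
  also have "\<dots> \<le> s" unfolding s_def
    by (rule member_le_sum) (use i in auto)
  finally have s: "s > 0" .
  obtain c where c: "cmod c = 1" "c * w $ n = - complex_of_real (cmod (w $ n))"
  proof (cases "w $ n = 0")
    case True then show ?thesis using that[of 1] by simp
  next
    case False
    let ?c = "- complex_of_real (cmod (w $ n)) / (w $ n)"
    have "cmod ?c = 1" using False by (simp add: norm_divide)
    then show ?thesis using that[of ?c] False by simp
  qed
  define v where "v i = c * w $ i / complex_of_real (sqrt s)" for i
  have cv: "cmod (v i) = cmod (w $ i) / sqrt s" for i
    using s c by (simp add: v_def norm_mult norm_divide)
  have "(\<Sum>i<Suc n. (cmod (v i))\<^sup>2) = s / s"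
    using s by (simp only: cv power_divide real_sqrt_pow2 less_imp_le sum_divide_distrib[symmetric] s_def[symmetric])
  moreover have "(\<Sum>j<Suc n. A i j * v j) = \<mu> * v i" if "i < Suc n" for i
  proof -
    have "(\<Sum>j<Suc n. A i j * v j) = c / complex_of_real (sqrt s) * (\<Sum>j<Suc n. A i j * w $ j)"
      unfolding sum_distrib_left by (rule sum.cong) (auto simp: v_def)
    then show ?thesis using ev[OF that] by (simp add: v_def)
  qed
  moreover have "v n = - complex_of_real (cmod (v n))"
    using c s by (simp add: cv) (simp add: v_def)
  ultimately show ?thesis using s by (intro exI[of _ v] exI[of _ \<mu>]) auto
qed

text \<open>A Householder reflection; the sign condition on the last coordinate keeps the
  denominator away from zero.\<close>

lemma unitary_with_last_column:
  assumes v: "(\<Sum>i<Suc n. (cmod (v i))\<^sup>2) = 1" "v n = - complex_of_real (cmod (v n))"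
  shows "\<exists>Q. funitary (Suc n) Q \<and> (\<forall>i<Suc n. Q i n = v i)"
proof -
  define t where "t = cmod (v n)"
  have t: "t \<ge> 0" "v n = - complex_of_real t" using v(2) by (auto simp: t_def)
  define u where "u i = v i - (if i = n then 1 else 0)" for i
  \<comment> \<open>The vector \<open>u\<close> has squared norm \<open>2 * (1 + t)\<close>, so
    \<open>c\<close> is 2 divided by that norm and \<open>Q\<close> is the reflection along
    \<open>u\<close>. It sends the last basis vector to \<open>v\<close> because the last coordinate
    of \<open>u\<close> is \<open>- (1 + t)\<close>.\<close>
  define c where "c = 1 / complex_of_real (1 + t)"
  define Q where "Q i j = (if i = j then 1 else 0) - c * u i * cnj (u j)" for i j
  have ct: "c * complex_of_real (1 + t) = 1" using t by (simp add: c_def del: of_real_add)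
  have uu: "(\<Sum>k<Suc n. u k * cnj (u k)) = complex_of_real (2 * (1 + t))"
  proof -
    have "(\<Sum>k<Suc n. u k * cnj (u k)) = (\<Sum>k<n. v k * cnj (v k)) + complex_of_real ((1 + t)\<^sup>2)"
      using t by (simp add: u_def power2_eq_square algebra_simps)
    also have "(\<Sum>k<n. v k * cnj (v k)) = complex_of_real (\<Sum>k<n. (cmod (v k))\<^sup>2)"
      by (simp add: complex_norm_square[symmetric])
    also have "(\<Sum>k<n. (cmod (v k))\<^sup>2) = 1 - t\<^sup>2" using v(1) by (simp add: t_def)
    finally show ?thesis by (simp add: power2_eq_square algebra_simps)
  qed
  have adj: "fadj Q = Q"
    by (auto simp: fadj_def Q_def fun_eq_iff c_def)
  have "fmult (Suc n) Q Q i j = (if i = j then 1 else 0)" if "i < Suc n" "j < Suc n" for i j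
  proof -
    have "fmult (Suc n) Q Q i j = (\<Sum>k<Suc n. (if k = i then (if i = j then 1 else 0) else 0)
        - (if k = i then c * u i * cnj (u j) else 0) - (if k = j then c * u i * cnj (u j) else 0)
        + c * c * u i * cnj (u j) * (u k * cnj (u k)))"
      unfolding fmult_def by (rule sum.cong) (auto simp: Q_def algebra_simps)
    also have "\<dots> = (if i = j then 1 else 0) - c * u i * cnj (u j) - c * u i * cnj (u j)
        + c * c * u i * cnj (u j) * complex_of_real (2 * (1 + t))"
      unfolding sum.distrib sum_subtractf sum_distrib_left[symmetric] uu
      using that by simp
    also have "c * c * u i * cnj (u j) * complex_of_real (2 * (1 + t))
        = 2 * c * u i * cnj (u j) * (c * complex_of_real (1 + t))" by simp
    finally show ?thesis unfolding ct by simp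
  qed
  then have "funitary (Suc n) Q"
    by (auto simp: funitary_def fm_eq_def fdiag_def adj)
  moreover have "Q i n = v i" for i
  proof -
    have "Q i n = (if i = n then 1 else 0) + u i * (c * complex_of_real (1 + t))"
      using t by (simp add: Q_def u_def algebra_simps)
    then show ?thesis unfolding ct by (simp add: u_def)
  qed
  ultimately show ?thesis by blast
qed

text \<open>Deflation: conjugating by a unitary whose last column is an eigenvector leaves a
  hermitian matrix with diagonal last row and column, and the induction hypothesis diagonalizes the
  remaining corner.\<close>

lemma hermitian_spectral:
  assumes "\<And>i j. i < n \<Longrightarrow> j < n \<Longrightarrow> H j i = cnj (H i j)"
  shows "\<exists>W l. funitary n W \<and>
    fm_eq n H (fmult n W (fmult n (fdiag (\<lambda>r. complex_of_real (l r))) (fadj W)))"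
  using assms
proof (induction n arbitrary: H)
  case 0
  then show ?case by (auto simp: fm_eq_def funitary_def)
next
  case (Suc n)
  let ?N = "Suc n"
  obtain v \<mu> where v: "(\<Sum>i<?N. (cmod (v i))\<^sup>2) = 1"
      "\<And>i. i < ?N \<Longrightarrow> (\<Sum>j<?N. H i j * v j) = \<mu> * v i" "v n = - complex_of_real (cmod (v n))"
    using unit_eigenvector_exists[of n H] by blast
  obtain Q where Q: "funitary ?N Q" "\<And>i. i < ?N \<Longrightarrow> Q i n = v i"
    using unitary_with_last_column[OF v(1,3)] by blast
  define K where "K = fmult ?N (fadj Q) (fmult ?N H Q)"
  have H_herm: "fm_eq ?N (fadj H) H"
    using Suc.prems[symmetric] by (simp add: fm_eq_def fadj_def)
  have K_herm: "fm_eq ?N (fadj K) K"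
    unfolding K_def fadj_fmult fadj_fadj fmult_assoc
    by (intro fm_eq_fmult fm_eq_refl H_herm)
  have Kcol: "K i n = (if i = n then \<mu> else 0)" if "i < ?N" for i
  proof -
    have "fmult ?N H Q k n = \<mu> * Q k n" if "k < ?N" for k
      using v(2)[OF that] Q(2) that by (simp add: fmult_def)
    then have "K i n = \<mu> * fmult ?N (fadj Q) Q i n"
      unfolding K_def fmult_def[of _ "fadj Q"] sum_distrib_left
      by (intro sum.cong) auto
    then show ?thesis
      using Q(1) that by (auto simp: funitary_def fm_eq_def fdiag_def)
  qed
  have Kh: "cnj (K i j) = K j i" if "i < ?N" "j < ?N" for i j
    using K_herm that by (simp add: fm_eq_def fadj_def)
  have mu_real: "complex_of_real (Re \<mu>) = \<mu>"
    using Kh[of n n] Kcol[of n] by (simp add: complex_eq_iff)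
  have Krow: "K n j = (if j = n then \<mu> else 0)" if "j < ?N" for j
    using Kh[of j n] Kcol[of j] Kcol[of n] Kh[of n n] that by (simp split: if_splits)
  obtain W' l' where W': "funitary n W'"
      "fm_eq n K (fmult n W' (fmult n (fdiag (\<lambda>r. complex_of_real (l' r))) (fadj W')))"
    using Suc.IH[of K] Kh[symmetric] by (metis less_Suc_eq)
  \<comment> \<open>The direct sum of \<open>W'\<close> with the 1 by 1 identity; the new eigenvalue
    takes the last place in \<open>l\<close>.\<close>
  define W where "W i r = (if i < n \<and> r < n then W' i r else if i = r then 1 else 0)" for i r
  define l where "l r = (if r < n then l' r else Re \<mu>)" for r
  have W_unitary: "funitary ?N W"
    using W'(1) unfolding funitary_def fm_eq_def
    by (auto simp: fmult_def fadj_def fdiag_def W_def less_Suc_eq)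
  have "fm_eq ?N K (fmult ?N W (fmult ?N (fdiag (\<lambda>r. complex_of_real (l r))) (fadj W)))"
  proof -
    have inner: "fmult ?N (fdiag (\<lambda>r. complex_of_real (l r))) (fadj W) i j
        = complex_of_real (l i) * cnj (W j i)" if "i < ?N" for i j
      using that by (simp add: fmult_def fdiag_def fadj_def if_distrib[of "\<lambda>x. x * _"] cong: if_cong)
    have inner': "fmult n (fdiag (\<lambda>r. complex_of_real (l' r))) (fadj W') i j
        = complex_of_real (l' i) * cnj (W' j i)" if "i < n" for i j
      using that by (simp add: fmult_def fdiag_def fadj_def if_distrib[of "\<lambda>x. x * _"] cong: if_cong)
    have K: "K i j = (\<Sum>r<n. W' i r * (complex_of_real (l' r) * cnj (W' j r)))" if "i < n" "j < n" for i j
      using W'(2) that inner' by (simp add: fm_eq_def fmult_def[of _ W'])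
    show ?thesis
      unfolding fm_eq_def fmult_def[of _ W]
    proof (intro allI impI)
      fix i j assume ij: "i < ?N" "j < ?N"
      have "(\<Sum>r<?N. W i r * fmult ?N (fdiag (\<lambda>r. complex_of_real (l r))) (fadj W) r j)
          = (\<Sum>r<?N. W i r * (complex_of_real (l r) * cnj (W j r)))"
        by (rule sum.cong) (auto simp: inner)
      also have "\<dots> = K i j"
        using ij K[of i j] Kcol[of i] Krow[of j] mu_real
        by (cases "i = n"; cases "j = n") (auto simp: W_def l_def less_Suc_eq)
      finally show "K i j = (\<Sum>r<?N. W i r * fmult ?N (fdiag (\<lambda>r. complex_of_real (l r))) (fadj W) r j)"
        by simp
    qed
  qed
  then have "fm_eq ?N (fmult ?N Q (fmult ?N K (fadj Q)))
     (fmult ?N Q (fmult ?N (fmult ?N W (fmult ?N (fdiag (\<lambda>r. complex_of_real (l r))) (fadj W))) (fadj Q)))"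
    by (intro fm_eq_fmult fm_eq_refl)
  moreover have "fm_eq ?N H (fmult ?N Q (fmult ?N K (fadj Q)))"
  proof -
    have "fm_eq ?N (fmult ?N Q (fmult ?N (fadj Q) (fmult ?N H (fmult ?N Q (fadj Q)))))
       (fmult ?N H (fmult ?N Q (fadj Q)))"
      by (rule fmult_cancel) (use Q in \<open>simp add: funitary_def\<close>)
    also have "fm_eq ?N \<dots> (fmult ?N H (fdiag (\<lambda>_. 1)))"
      by (intro fm_eq_fmult fm_eq_refl) (use Q in \<open>simp add: funitary_def\<close>)
    also have "fm_eq ?N \<dots> H" by (rule fmult_one)
    finally show ?thesis unfolding K_def fmult_assoc by (rule fm_eq_sym)
  qed
  ultimately have "fm_eq ?N H (fmult ?N (fmult ?N Q W) (fmult ?N (fdiag (\<lambda>r. complex_of_real (l r)))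
      (fadj (fmult ?N Q W))))"
    by (auto simp: fadj_fmult fmult_assoc intro: fm_eq_trans)
  with funitary_fmult[OF Q(1) W_unitary] show ?case by blast
qed

section \<open>Operator norms and Hilbert--Schmidt factorization\<close>

text \<open>The squared Hilbert-Schmidt norm is the trace of \<open>M M\<^sup>*\<close> and hence
  unitarily invariant. It will be used for the eigenvalues and for their absolute values, showing
  that a hermitian matrix and its absolute value have the same norm.\<close>

lemma hilbert_schmidt_spectral:
  fixes d :: "nat \<Rightarrow> real"
  assumes W: "funitary n W"
    and M: "fm_eq n M (fmult n W (fmult n (fdiag (\<lambda>r. complex_of_real (d r))) (fadj W)))"
  shows "(\<Sum>i<n. \<Sum>j<n. (cmod (M i j))\<^sup>2) = (\<Sum>r<n. (d r)\<^sup>2)"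
proof -
  let ?D = "fdiag (\<lambda>r. complex_of_real (d r))"
  have adjD: "fadj ?D = ?D" by (auto simp: fadj_def fdiag_def fun_eq_iff)
  have M': "fm_eq n (fadj M) (fmult n W (fmult n ?D (fadj W)))"
  proof -
    have "fm_eq n (fadj M) (fadj (fmult n W (fmult n ?D (fadj W))))"
      using M by (simp add: fm_eq_def fadj_def)
    then show ?thesis by (simp add: fadj_fmult adjD fmult_assoc)
  qed
  have "fm_eq n (fmult n M (fadj M)) (fmult n W (fmult n ?D (fmult n (fadj W) (fmult n W (fmult n ?D (fadj W))))))"
    using fm_eq_fmult[OF M M'] by (simp add: fmult_assoc)
  also have "fm_eq n \<dots> (fmult n W (fmult n ?D (fmult n ?D (fadj W))))"
    by (intro fm_eq_fmult fm_eq_refl fmult_cancel) (use W in \<open>simp add: funitary_def\<close>)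
  finally have MM: "fmult n M (fadj M) i i = fmult n W (fmult n ?D (fmult n ?D (fadj W))) i i" if "i < n" for i
    using that by (simp add: fm_eq_def)
  have D: "fmult n ?D A r j = complex_of_real (d r) * A r j" if "r < n" for A r j
    using that by (simp add: fmult_def fdiag_def if_distrib[of "\<lambda>x. x * _"] cong: if_cong)
  have "complex_of_real (\<Sum>i<n. \<Sum>j<n. (cmod (M i j))\<^sup>2) = (\<Sum>i<n. fmult n M (fadj M) i i)"
    by (simp add: fmult_def fadj_def complex_norm_square del: of_real_power)
  also have "\<dots> = (\<Sum>i<n. \<Sum>r<n. complex_of_real ((d r)\<^sup>2) * (cnj (W i r) * W i r))"
    unfolding fmult_def[of _ W] using MM
    by (auto intro!: sum.cong simp: D fmult_def[of _ W] fadj_def power2_eq_square)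
  also have "\<dots> = (\<Sum>r<n. complex_of_real ((d r)\<^sup>2) * fmult n (fadj W) W r r)"
    by (subst sum.swap) (simp add: fmult_def fadj_def sum_distrib_left)
  also have "\<dots> = (\<Sum>r<n. complex_of_real ((d r)\<^sup>2))"
    using W by (intro sum.cong) (auto simp: funitary_def fm_eq_def fdiag_def)
  also have "\<dots> = complex_of_real (\<Sum>r<n. (d r)\<^sup>2)" by simp
  finally show ?thesis unfolding of_real_eq_iff .
qed

section \<open>Euclidean norms, sesquilinear forms and operator norms over a finite index
  set\<close>

definition vnorm :: "'i set \<Rightarrow> ('i \<Rightarrow> complex) \<Rightarrow> real" where
  "vnorm I v = L2_set (\<lambda>p. cmod (v p)) I"

definition sform :: "'i set \<Rightarrow> ('i \<Rightarrow> 'i \<Rightarrow> complex) \<Rightarrow> ('i \<Rightarrow> complex) \<Rightarrow> ('i \<Rightarrow> complex) \<Rightarrow> complex" where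
  "sform I A u v = (\<Sum>p\<in>I. \<Sum>q\<in>I. cnj (u p) * A p q * v q)"

lemma vnorm_nonneg [simp]: "0 \<le> vnorm I v"
  by (simp add: vnorm_def)

lemma vnorm_power2: "(vnorm I v)\<^sup>2 = (\<Sum>p\<in>I. (cmod (v p))\<^sup>2)"
  by (simp add: vnorm_def L2_set_def sum_nonneg)

lemma vnorm_scale: "vnorm I (\<lambda>p. c * v p) = cmod c * vnorm I v"
  by (simp add: vnorm_def norm_mult L2_set_right_distrib)

lemma vnorm_cong: "(\<And>p. p \<in> I \<Longrightarrow> u p = v p) \<Longrightarrow> vnorm I u = vnorm I v"
  by (simp add: vnorm_def cong: L2_set_cong_simp)

lemma vnorm_eq_0_iff: "finite I \<Longrightarrow> vnorm I v = 0 \<longleftrightarrow> (\<forall>p\<in>I. v p = 0)"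
  by (simp add: vnorm_def L2_set_eq_0_iff)

lemma sum_cnj_mult_le: "cmod (\<Sum>p\<in>I. cnj (u p) * w p) \<le> vnorm I u * vnorm I w"
proof -
  have "cmod (\<Sum>p\<in>I. cnj (u p) * w p) \<le> (\<Sum>p\<in>I. \<bar>cmod (u p)\<bar> * \<bar>cmod (w p)\<bar>)"
    by (rule order_trans[OF norm_sum]) (simp add: norm_mult)
  also have "\<dots> \<le> vnorm I u * vnorm I w"
    unfolding vnorm_def by (rule L2_set_mult_ineq)
  finally show ?thesis .
qed

lemma sform_alt: "sform I A u v = (\<Sum>p\<in>I. cnj (u p) * (\<Sum>q\<in>I. A p q * v q))"
  by (simp add: sform_def sum_distrib_left mult.assoc)

lemma sform_cong:
  "(\<And>p q. p \<in> I \<Longrightarrow> q \<in> I \<Longrightarrow> A p q = B p q) \<Longrightarrow> (\<And>p. p \<in> I \<Longrightarrow> u p = u' p) \<Longrightarrow>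
   (\<And>p. p \<in> I \<Longrightarrow> v p = v' p) \<Longrightarrow> sform I A u v = sform I B u' v'"
  unfolding sform_def by (intro sum.cong refl) simp

lemma cpos_sform: "cpos I A \<longleftrightarrow> (\<forall>v. 0 \<le> sform I A v v)"
  by (simp add: cpos_def sform_def)

lemma sform_scale_left: "sform I A (\<lambda>p. c * u p) v = cnj c * sform I A u v"
  by (simp add: sform_def sum_distrib_left mult.assoc)

lemma sform_scale_right: "sform I A u (\<lambda>p. c * v p) = c * sform I A u v"
  by (simp add: sform_def sum_distrib_left mult_ac)

lemma sform_add_left: "sform I A (\<lambda>p. u p + u' p) v = sform I A u v + sform I A u' v"
  by (simp add: sform_def sum.distrib algebra_simps)

lemma sform_add_right: "sform I A u (\<lambda>p. v p + v' p) = sform I A u v + sform I A u v'"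
  by (simp add: sform_def sum.distrib algebra_simps)

lemma sform_self: "sform I A (\<lambda>p. \<Sum>q\<in>I. A p q * v q) v
    = complex_of_real ((vnorm I (\<lambda>p. \<Sum>q\<in>I. A p q * v q))\<^sup>2)"
  unfolding sform_alt vnorm_power2 of_real_sum
  by (rule sum.cong) (simp_all add: complex_norm_square mult.commute del: of_real_power)

lemma copnorm_alt:
  "copnorm I A = Sup {vnorm I (\<lambda>p. \<Sum>q\<in>I. A p q * v q) | v. vnorm I v \<le> 1}"
  by (simp add: copnorm_def vnorm_def L2_set_def)

lemma copnorm_upper:
  assumes "finite I" "vnorm I v \<le> 1"
  shows "vnorm I (\<lambda>p. \<Sum>q\<in>I. A p q * v q) \<le> copnorm I A"
  unfolding copnorm_alt
proof (rule cSup_upper)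
  show "bdd_above {vnorm I (\<lambda>p. \<Sum>q\<in>I. A p q * v q) | v. vnorm I v \<le> 1}"
  proof (rule bdd_aboveI)
    fix x assume "x \<in> {vnorm I (\<lambda>p. \<Sum>q\<in>I. A p q * v q) | v. vnorm I v \<le> 1}"
    then obtain v where v: "x = vnorm I (\<lambda>p. \<Sum>q\<in>I. A p q * v q)" "vnorm I v \<le> 1" by auto
    \<comment> \<open>The Hilbert-Schmidt norm of \<open>A\<close>, written as the norm of the
      vector of row norms, is an a priori bound. Without one, the supremum of reals would carry no
      information.\<close>
    show "x \<le> L2_set (\<lambda>p. vnorm I (\<lambda>q. cnj (A p q))) I"
      unfolding v(1) vnorm_def[of I "\<lambda>p. \<Sum>q\<in>I. A p q * v q"]
    proof (rule L2_set_mono)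
      fix p assume "p \<in> I"
      show "cmod (\<Sum>q\<in>I. A p q * v q) \<le> vnorm I (\<lambda>q. cnj (A p q))"
        using sum_cnj_mult_le[of "\<lambda>q. cnj (A p q)" v I] mult_left_le[OF v(2), of "vnorm I (\<lambda>q. cnj (A p q))"]
        by simp
    qed simp
  qed
qed (use assms in auto)

lemma copnorm_nonneg: "finite I \<Longrightarrow> 0 \<le> copnorm I A"
  by (rule order_trans[OF vnorm_nonneg copnorm_upper[of I "\<lambda>_. 0"]]) (auto simp: vnorm_def L2_set_def)

lemma vnorm_apply_le:
  assumes "finite I"
  shows "vnorm I (\<lambda>p. \<Sum>q\<in>I. A p q * v q) \<le> copnorm I A * vnorm I v"
proof (cases "vnorm I v = 0")
  case True
  then have "vnorm I (\<lambda>p. \<Sum>q\<in>I. A p q * v q) = 0"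
    using assms by (simp add: vnorm_eq_0_iff)
  then show ?thesis using True by simp
next
  case False
  let ?c = "complex_of_real (1 / vnorm I v)"
  have c: "cmod ?c = 1 / vnorm I v" unfolding norm_of_real by simp
  have "vnorm I (\<lambda>q. ?c * v q) \<le> 1"
    unfolding vnorm_scale c using False by simp
  from copnorm_upper[OF assms this, of A]
  have "vnorm I (\<lambda>p. ?c * (\<Sum>q\<in>I. A p q * v q)) \<le> copnorm I A"
    by (simp only: sum_distrib_left mult.left_commute)
  then have "vnorm I (\<lambda>p. \<Sum>q\<in>I. A p q * v q) / vnorm I v \<le> copnorm I A"
    unfolding vnorm_scale c by simp
  moreover have "0 < vnorm I v" using False by (simp add: less_le)
  ultimately show ?thesis by (simp add: divide_le_eq)
qed

lemma sform_le_copnorm: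
  assumes "finite I"
  shows "cmod (sform I A u v) \<le> copnorm I A * vnorm I u * vnorm I v"
proof -
  have "cmod (sform I A u v) \<le> vnorm I u * vnorm I (\<lambda>p. \<Sum>q\<in>I. A p q * v q)"
    unfolding sform_alt by (rule sum_cnj_mult_le)
  also have "\<dots> \<le> vnorm I u * (copnorm I A * vnorm I v)"
    by (intro mult_left_mono vnorm_apply_le assms) simp
  finally show ?thesis by (simp add: mult_ac)
qed

text \<open>For \<open>u = A v / |A v|\<close> the hypothesis reads
  \<open>2 |A v| \<le> c (1 + |v|\<^sup>2)\<close>. The additive right-hand side is the form in
  which bounds arise from the parallelogram law and from positivity of a 2 by 2 block
  matrix.\<close>

lemma copnorm_le_Re:
  assumes "0 \<le> c" and *: "\<And>u v. 2 * Re (sform I A u v) \<le> c * ((vnorm I u)\<^sup>2 + (vnorm I v)\<^sup>2)"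
  shows "copnorm I A \<le> c"
  unfolding copnorm_alt
proof (rule cSup_least)
  show "{vnorm I (\<lambda>p. \<Sum>q\<in>I. A p q * v q) | v. vnorm I v \<le> 1} \<noteq> {}"
    by (auto simp: vnorm_def L2_set_def intro: exI[of _ "\<lambda>_. 0"])
  fix x assume "x \<in> {vnorm I (\<lambda>p. \<Sum>q\<in>I. A p q * v q) | v. vnorm I v \<le> 1}"
  then obtain v where v: "x = vnorm I (\<lambda>p. \<Sum>q\<in>I. A p q * v q)" "vnorm I v \<le> 1" by auto
  show "x \<le> c"
  proof (cases "x = 0")
    case False
    then have x: "x > 0" using v by (simp add: less_le)
    let ?c = "complex_of_real (1 / x)"
    have c: "cmod ?c = 1 / x" unfolding norm_of_real using x by simp
    have "2 * Re (cnj ?c * complex_of_real (x\<^sup>2)) \<le> c * ((1 / x * x)\<^sup>2 + (vnorm I v)\<^sup>2)"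
      using *[of "\<lambda>p. ?c * (\<Sum>q\<in>I. A p q * v q)" v]
      unfolding sform_scale_left vnorm_scale sform_self v(1)[symmetric] c .
    also have "\<dots> \<le> c * (1 + 1)"
      using v(2) x assms(1) by (intro mult_left_mono add_mono) (auto simp: power_le_one)
    finally show ?thesis using x by (simp add: power2_eq_square)
  qed (use assms in simp)
qed

lemma copnorm_leI:
  assumes "0 \<le> c" and *: "\<And>u v. cmod (sform I A u v) \<le> c * vnorm I u * vnorm I v"
  shows "copnorm I A \<le> c"
proof (rule copnorm_le_Re[OF assms(1)])
  fix u v
  have "Re (sform I A u v) \<le> c * (vnorm I u * vnorm I v)"
    using *[of u v] complex_Re_le_cmod[of "sform I A u v"] by (simp add: mult.assoc)
  moreover have "2 * (vnorm I u * vnorm I v) \<le> (vnorm I u)\<^sup>2 + (vnorm I v)\<^sup>2"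
    using sum_squares_bound[of "vnorm I u" "vnorm I v"] by simp
  then have "c * (2 * (vnorm I u * vnorm I v)) \<le> c * ((vnorm I u)\<^sup>2 + (vnorm I v)\<^sup>2)"
    using assms(1) by (rule mult_left_mono)
  ultimately show "2 * Re (sform I A u v) \<le> c * ((vnorm I u)\<^sup>2 + (vnorm I v)\<^sup>2)" by simp
qed

section \<open>Hermitian matrices and their quadratic forms\<close>

definition hermitian_on :: "'i set \<Rightarrow> ('i \<Rightarrow> 'i \<Rightarrow> complex) \<Rightarrow> bool" where
  "hermitian_on I A \<longleftrightarrow> (\<forall>p\<in>I. \<forall>q\<in>I. cnj (A p q) = A q p)"

lemma sform_hermitian:
  assumes "hermitian_on I A"
  shows "cnj (sform I A u v) = sform I A v u"
proof -
  have "cnj (sform I A u v) = (\<Sum>p\<in>I. \<Sum>q\<in>I. cnj (v q) * A q p * u p)"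
    unfolding sform_def cnj_sum using assms
    by (intro sum.cong refl) (simp add: hermitian_on_def mult_ac)
  also have "\<dots> = sform I A v u" unfolding sform_def by (rule sum.swap)
  finally show ?thesis .
qed

lemma sform_hermitian_real:
  assumes "hermitian_on I A"
  shows "sform I A v v = complex_of_real (Re (sform I A v v))"
  using sform_hermitian[OF assms, of v v] by (simp add: complex_eq_iff)

text \<open>In the order on complex numbers, \<open>0 \<le> z\<close> includes that \<open>z\<close>
  is real. For hermitian matrices this is automatic, so that all later positivity arguments are
  estimates of real parts.\<close>

lemma cpos_hermitian: "hermitian_on I A \<Longrightarrow> cpos I A \<longleftrightarrow> (\<forall>v. 0 \<le> Re (sform I A v v))"
  using sform_hermitian_real[of I A] by (force simp: cpos_sform less_eq_complex_def complex_eq_iff)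

lemma hermitian_sform_polarization:
  assumes "hermitian_on I A"
  shows "4 * Re (sform I A u v) = Re (sform I A (\<lambda>p. u p + v p) (\<lambda>p. u p + v p))
     - Re (sform I A (\<lambda>p. u p + (-1) * v p) (\<lambda>p. u p + (-1) * v p))"
  unfolding sform_add_left sform_add_right sform_scale_left sform_scale_right
  using arg_cong[OF sform_hermitian[OF assms, of u v], of Re] by simp

lemma vnorm_parallelogram:
  "(vnorm I (\<lambda>p. u p + v p))\<^sup>2 + (vnorm I (\<lambda>p. u p + (-1) * v p))\<^sup>2 = 2 * ((vnorm I u)\<^sup>2 + (vnorm I v)\<^sup>2)"
  unfolding vnorm_power2 sum.distrib[symmetric] sum_distrib_left
  by (rule sum.cong) (auto simp: cmod_power2, auto simp: power2_eq_square algebra_simps)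

text \<open>The norm of a hermitian matrix is its numerical radius: polarization expresses the
  sesquilinear form by two quadratic values, and the parallelogram law adds up their bounds.\<close>

lemma copnorm_le_hermitian:
  assumes "hermitian_on I A" "0 \<le> c" "\<And>v. \<bar>Re (sform I A v v)\<bar> \<le> c * (vnorm I v)\<^sup>2"
  shows "copnorm I A \<le> c"
proof (rule copnorm_le_Re[OF assms(2)])
  fix u v
  have "4 * Re (sform I A u v) \<le> c * (vnorm I (\<lambda>p. u p + v p))\<^sup>2 + c * (vnorm I (\<lambda>p. u p + (-1) * v p))\<^sup>2"
    unfolding hermitian_sform_polarization[OF assms(1)]
    using assms(3)[of "\<lambda>p. u p + v p"] assms(3)[of "\<lambda>p. u p + (-1) * v p"] by (auto simp: abs_le_iff)
  also have "\<dots> = 2 * (c * ((vnorm I u)\<^sup>2 + (vnorm I v)\<^sup>2))"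
    unfolding distrib_left[symmetric] vnorm_parallelogram by simp
  finally show "2 * Re (sform I A u v) \<le> c * ((vnorm I u)\<^sup>2 + (vnorm I v)\<^sup>2)" by simp
qed

lemma finite_idx [simp]: "finite (idx n m)"
  by (simp add: idx_def)

lemma vnorm_idx: "(vnorm (idx n m) v)\<^sup>2 = (\<Sum>i<n. \<Sum>j<m. (cmod (v (i, j)))\<^sup>2)"
  by (simp add: vnorm_power2 idx_def sum.cartesian_product)

lemma sum_lessThan_add: "(\<Sum>i<n + m. f i) = (\<Sum>i<n. f i) + (\<Sum>i<m. f (n + i))"
  for f :: "nat \<Rightarrow> 'a::comm_monoid_add"
  by (induction m) (auto simp: add.assoc)

text \<open>The spectral decomposition of the hermitian dilation of \<open>U\<close> gives \<open>U = A B\<^sup>*\<close> where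
  \<open>A A\<^sup>*\<close> and \<open>B B\<^sup>*\<close> are the diagonal blocks of the absolute value of the dilation.\<close>

lemma hilbert_schmidt_factorization:
  fixes U :: "nat \<times> nat \<Rightarrow> complex"
  shows "\<exists>N a b. (\<forall>i<n. \<forall>j<m. U (i, j) = (\<Sum>r<N. a r i * cnj (b r j))) \<and>
    vnorm (idx n n) (\<lambda>(i, j). \<Sum>r<N::nat. a r i * cnj (a r j)) *
    vnorm (idx m m) (\<lambda>(i, j). \<Sum>r<N. b r i * cnj (b r j)) \<le> (vnorm (idx n m) U)\<^sup>2"
proof -
  let ?N = "n + m"
  define H where "H i j = (if i < n \<and> n \<le> j then U (i, j - n)
      else if n \<le> i \<and> j < n then cnj (U (j, i - n)) else 0)" for i j
  have "\<exists>W l. funitary ?N W \<and>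
    fm_eq ?N H (fmult ?N W (fmult ?N (fdiag (\<lambda>r. complex_of_real (l r))) (fadj W)))"
    by (rule hermitian_spectral) (auto simp: H_def)
  then obtain W l where W: "funitary ?N W" and
    l: "fm_eq ?N H (fmult ?N W (fmult ?N (fdiag (\<lambda>r. complex_of_real (l r))) (fadj W)))"
    by blast
  have spec: "fmult ?N W (fmult ?N (fdiag (\<lambda>r. complex_of_real (d r))) (fadj W)) i j
      = (\<Sum>r<?N. complex_of_real (d r) * W i r * cnj (W j r))" for d i j
  proof -
    have "fmult ?N (fdiag (\<lambda>r. complex_of_real (d r))) (fadj W) r j
        = complex_of_real (d r) * cnj (W j r)" if "r < ?N" for r
      using that by (simp add: fmult_def fdiag_def fadj_def if_distrib[of "\<lambda>x. x * _"] cong: if_cong)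
    then show ?thesis unfolding fmult_def[of _ W] by (intro sum.cong) auto
  qed
  define a where "a r i = complex_of_real (sqrt \<bar>l r\<bar>) * W i r" for r i
  \<comment> \<open>The sign of the eigenvalue is absorbed into \<open>b\<close>, so that
    \<open>A B\<^sup>*\<close> recovers \<open>H\<close> while both \<open>A A\<^sup>*\<close> and
    \<open>B B\<^sup>*\<close> carry only absolute values. A zero eigenvalue contributes nothing to
    either.\<close>
  define b where "b r j = complex_of_real (sgn (l r) * sqrt \<bar>l r\<bar>) * W (n + j) r" for r j
  define M where "M i j = (\<Sum>r<?N. complex_of_real \<bar>l r\<bar> * W i r * cnj (W j r))" for i j
  have U: "U (i, j) = (\<Sum>r<?N. a r i * cnj (b r j))" if "i < n" "j < m" for i j
  proof -
    have "U (i, j) = H i (n + j)" using that by (simp add: H_def)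
    also have "\<dots> = (\<Sum>r<?N. complex_of_real (l r) * W i r * cnj (W (n + j) r))"
      using l that by (simp add: fm_eq_def spec)
    also have "\<dots> = (\<Sum>r<?N. a r i * cnj (b r j))"
    proof (rule sum.cong)
      fix r
      have "complex_of_real (l r) = complex_of_real (sqrt \<bar>l r\<bar> * (sgn (l r) * sqrt \<bar>l r\<bar>))"
        by (cases "l r" "0::real" rule: linorder_cases) auto
      then show "complex_of_real (l r) * W i r * cnj (W (n + j) r) = a r i * cnj (b r j)"
        by (simp add: a_def b_def)
    qed simp
    finally show ?thesis .
  qed
  have aa: "(\<Sum>r<?N. a r i * cnj (a r j)) = M i j" for i j
    unfolding M_def
  proof (rule sum.cong)
    fix r
    have "complex_of_real (sqrt \<bar>l r\<bar>) * complex_of_real (sqrt \<bar>l r\<bar>) = complex_of_real \<bar>l r\<bar>"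
      by (simp flip: of_real_mult)
    then show "a r i * cnj (a r j) = complex_of_real \<bar>l r\<bar> * W i r * cnj (W j r)"
      by (simp add: a_def)
  qed simp
  have bb: "(\<Sum>r<?N. b r i * cnj (b r j)) = M (n + i) (n + j)" for i j
    unfolding M_def
  proof (rule sum.cong)
    fix r
    let ?s = "sgn (l r) * sqrt \<bar>l r\<bar>"
    have "\<bar>l r\<bar> = ?s * ?s"
      by (cases "l r" "0::real" rule: linorder_cases) auto
    then have "complex_of_real \<bar>l r\<bar> = complex_of_real ?s * complex_of_real ?s"
      unfolding of_real_mult[symmetric] by (rule arg_cong)
    then show "b r i * cnj (b r j) = complex_of_real \<bar>l r\<bar> * W (n + i) r * cnj (W (n + j) r)"
      by (simp add: b_def del: of_real_mult)
  qed simp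
  let ?f = "\<lambda>i j. (cmod (M i j))\<^sup>2"
  \<comment> \<open>Dropping the off-diagonal blocks of the absolute value only decreases its norm.
    The dilation contains \<open>U\<close> twice, whence the factor 2, which the inequality between
    geometric and arithmetic mean then cancels.\<close>
  have "(vnorm (idx n n) (\<lambda>(i, j). M i j))\<^sup>2 + (vnorm (idx m m) (\<lambda>(i, j). M (n + i) (n + j)))\<^sup>2
      \<le> (\<Sum>i<?N. \<Sum>j<?N. ?f i j)"
    unfolding vnorm_idx sum_lessThan_add sum.distrib by (simp add: sum_nonneg)
  also have "\<dots> = (\<Sum>r<?N. \<bar>l r\<bar>\<^sup>2)"
    by (rule hilbert_schmidt_spectral[OF W]) (simp add: fm_eq_def spec M_def)
  also have "\<dots> = (\<Sum>i<?N. \<Sum>j<?N. (cmod (H i j))\<^sup>2)"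
    using hilbert_schmidt_spectral[OF W l] by simp
  also have "\<dots> = 2 * (vnorm (idx n m) U)\<^sup>2"
    unfolding vnorm_idx sum_lessThan_add sum.distrib
    by (simp add: H_def) (rule sum.swap)
  finally have "vnorm (idx n n) (\<lambda>(i, j). M i j) * vnorm (idx m m) (\<lambda>(i, j). M (n + i) (n + j))
      \<le> (vnorm (idx n m) U)\<^sup>2"
    using sum_squares_bound[of "vnorm (idx n n) (\<lambda>(i, j). M i j)" "vnorm (idx m m) (\<lambda>(i, j). M (n + i) (n + j))"]
    by linarith
  then show ?thesis
    by (intro exI[of _ ?N] exI[of _ a] exI[of _ b]) (simp add: U aa bb)
qed

section \<open>The matrix pairing\<close>

lemma sum_swap_nested:
  "(\<Sum>i\<in>A. \<Sum>j\<in>B. \<Sum>k\<in>C. \<Sum>l\<in>D. \<Sum>r\<in>E. \<Sum>s\<in>F. g i j k l r s)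
   = (\<Sum>r\<in>E. \<Sum>s\<in>F. \<Sum>i\<in>A. \<Sum>k\<in>C. \<Sum>j\<in>B. \<Sum>l\<in>D. g i j k l r s)"
  unfolding sum.cartesian_product
  by (rule sum.reindex_bij_witness[of _ "\<lambda>(r, s, i, k, j, l). (i, j, k, l, r, s)"
        "\<lambda>(i, j, k, l, r, s). (r, s, i, k, j, l)"]) auto

locale unital_hilbert =
  fixes sm :: "complex \<Rightarrow> 'h::ab_group_add \<Rightarrow> 'h" and ip :: "'h \<Rightarrow> 'h \<Rightarrow> complex"
    and st :: "'h \<Rightarrow> 'h" and e :: 'h
  assumes unital: "unital_hilbert_space sm ip st e"
begin

lemma sm_add_right: "sm a (x + y) = sm a x + sm a y"
  and sm_add_left: "sm (a + b) x = sm a x + sm b x"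
  and sm_mult: "sm (a * b) x = sm a (sm b x)"
  and sm_one [simp]: "sm 1 x = x"
  and ip_add_left: "ip (x + y) z = ip x z + ip y z"
  and ip_scale_left: "ip (sm c x) y = c * ip x y"
  and ip_self_nonneg: "0 \<le> ip x x"
  and ip_self_eq_0: "ip x x = 0 \<Longrightarrow> x = 0"
  and st_add: "st (x + y) = st x + st y"
  and st_scale: "st (sm c x) = sm (cnj c) (st x)"
  and st_st [simp]: "st (st x) = x"
  and ip_st: "ip (st x) (st y) = cnj (ip x y)"
  and st_e [simp]: "st e = e"
  using unital unfolding unital_hilbert_space_def hilbert_star_space_def complex_vs_def by metis+

lemma cnj_ip: "cnj (ip x y) = ip y x"
  using unital unfolding unital_hilbert_space_def hilbert_star_space_def by metis

lemma ip_e_e [simp]: "ip e e = 1"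
  using unital ip_self_nonneg[of e]
  by (auto simp: unital_hilbert_space_def hnorm_def complex_eq_iff less_eq_complex_def)

lemma ip_add_right: "ip z (x + y) = ip z x + ip z y"
  by (metis cnj_ip complex_cnj_add ip_add_left)

lemma ip_scale_right: "ip x (sm c y) = cnj c * ip x y"
  by (metis cnj_ip complex_cnj_mult ip_scale_left)

lemma ip_zero_left [simp]: "ip 0 y = 0"
  using ip_add_left[of 0 0 y] by simp

lemma ip_zero_right [simp]: "ip y 0 = 0"
  using ip_add_right[of y 0 0] by simp

lemma st_zero [simp]: "st 0 = 0"
  using st_add[of 0 0] by simp

lemma sm_zero_right [simp]: "sm c 0 = 0"
  using sm_add_right[of c 0 0] by simp

lemma sm_zero_left [simp]: "sm 0 x = 0"
  using sm_add_left[of 0 0 x] by simp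

lemma ip_minus_left: "ip (- x) y = - ip x y"
  using ip_add_left[of x "- x" y] by (simp add: eq_neg_iff_add_eq_0 add.commute)

lemma ip_diff_left: "ip (x - z) y = ip x y - ip z y"
  using ip_add_left[of x "- z" y] by (simp add: ip_minus_left)

lemma st_minus: "st (- x) = - st x"
  using st_add[of x "- x"] by (simp add: eq_neg_iff_add_eq_0 add.commute)

lemma st_diff: "st (x - y) = st x - st y"
  using st_add[of x "- y"] by (simp add: st_minus)

lemma sm_minus_right: "sm c (- x) = - sm c x"
  using sm_add_right[of c x "- x"] by (simp add: eq_neg_iff_add_eq_0 add.commute)

lemma sm_diff_right: "sm c (x - y) = sm c x - sm c y"
  using sm_add_right[of c x "- y"] by (simp add: sm_minus_right)

lemma sm_minus_left: "sm (- c) x = - sm c x"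
  using sm_add_left[of c "- c" x] by (simp add: eq_neg_iff_add_eq_0 add.commute)

lemma ip_sum_left: "ip (sum f A) y = (\<Sum>i\<in>A. ip (f i) y)"
  by (induction A rule: infinite_finite_induct) (auto simp: ip_add_left)

lemma ip_sum_right: "ip y (sum f A) = (\<Sum>i\<in>A. ip y (f i))"
  by (induction A rule: infinite_finite_induct) (auto simp: ip_add_right)

lemma st_sum: "st (sum f A) = (\<Sum>i\<in>A. st (f i))"
  by (induction A rule: infinite_finite_induct) (auto simp: st_add)

lemma ip_st_e: "ip (st x) e = cnj (ip x e)"
  using ip_st[of x e] by simp

lemma hnorm_nonneg: "0 \<le> hnorm ip x"
  using ip_self_nonneg[of x] by (simp add: hnorm_def less_eq_complex_def)

lemma ip_self: "ip x x = complex_of_real ((hnorm ip x)\<^sup>2)"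
  using ip_self_nonneg[of x] by (auto simp: hnorm_def less_eq_complex_def complex_eq_iff)

lemma cauchy_schwarz: "cmod (ip x y) \<le> hnorm ip x * hnorm ip y"
proof (cases "hnorm ip y = 0")
  case True
  then have "y = 0" using ip_self[of y] ip_self_eq_0 by simp
  then show ?thesis using hnorm_nonneg by simp
next
  case False
  let ?N = "complex_of_real ((hnorm ip y)\<^sup>2)"
  define c where "c = ip x y / ?N"
  have cc: "c * cnj (ip x y) = complex_of_real ((cmod (ip x y))\<^sup>2 / (hnorm ip y)\<^sup>2)"
    unfolding c_def using complex_norm_square[of "ip x y"] by simp
  have "ip (x - sm c y) (x - sm c y) = ip x x - c * ip y x - cnj c * (ip x y - c * ip y y)"
  proof -
    have L: "ip (x - sm c y) z = ip x z - c * ip y z" for z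
      by (simp add: ip_diff_left ip_scale_left)
    have R: "ip z (x - sm c y) = ip z x - cnj c * ip z y" for z
      by (metis cnj_ip complex_cnj_diff complex_cnj_mult ip_diff_left ip_scale_left)
    show ?thesis unfolding L R by (simp add: algebra_simps)
  qed
  also have "c * ip y y = ip x y"
    using False by (simp add: c_def ip_self)
  finally have "ip (x - sm c y) (x - sm c y) = ip x x - c * cnj (ip x y)"
    by (simp add: cnj_ip)
  then have "0 \<le> (hnorm ip x)\<^sup>2 - (cmod (ip x y))\<^sup>2 / (hnorm ip y)\<^sup>2"
    using ip_self_nonneg[of "x - sm c y"] unfolding cc ip_self[of x]
    by (simp add: less_eq_complex_def del: of_real_power of_real_divide)
  moreover have "(hnorm ip y)\<^sup>2 > 0" using False by simp
  ultimately have "(cmod (ip x y))\<^sup>2 \<le> (hnorm ip x * hnorm ip y)\<^sup>2"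
    by (simp add: divide_le_eq power_mult_distrib)
  then show ?thesis by (rule power2_le_imp_le) (simp add: hnorm_nonneg)
qed

abbreviation pform :: "nat \<Rightarrow> nat \<Rightarrow> 'h hmat \<Rightarrow> 'h hmat \<Rightarrow> (nat \<times> nat \<Rightarrow> complex) \<Rightarrow> (nat \<times> nat \<Rightarrow> complex) \<Rightarrow> complex" where
  "pform n m x y \<equiv> sform (idx n m) (mpair ip n m x y)"

lemma pform_idx: "pform n m x y u v = (\<Sum>p\<in>idx n m. \<Sum>q\<in>idx n m.
    cnj (u p) * ip (x (fst p) (fst q)) (y (snd p) (snd q)) * v q)"
  unfolding sform_def by (intro sum.cong refl) (auto simp: mpair_def idx_def)

lemma pform_expand: "pform n m x y u v = (\<Sum>i<n. \<Sum>j<m. \<Sum>k<n. \<Sum>l<m.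
    cnj (u (i, j)) * ip (x i k) (y j l) * v (k, l))"
  unfolding pform_idx by (simp add: idx_def sum.cartesian_product')

lemma pform_madd_left: "pform n m (madd x x') y u v = pform n m x y u v + pform n m x' y u v"
  by (simp add: pform_idx madd_def ip_add_left algebra_simps sum.distrib)

lemma pform_madd_right: "pform n m x (madd y y') u v = pform n m x y u v + pform n m x y' u v"
  by (simp add: pform_idx madd_def ip_add_right algebra_simps sum.distrib)

lemma pform_scale_left: "pform n m (\<lambda>i j. sm c (x i j)) y u v = c * pform n m x y u v"
  by (simp add: pform_idx ip_scale_left sum_distrib_left mult_ac)

lemma pform_scale_right: "pform n m x (\<lambda>i j. sm c (y i j)) u v = cnj c * pform n m x y u v"
  by (simp add: pform_idx ip_scale_right sum_distrib_left mult_ac)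

lemma pform_uminus_left: "pform n m (\<lambda>i j. - x i j) y u v = - pform n m x y u v"
  by (simp add: pform_idx ip_minus_left sum_negf)

text \<open>The two components of the index change places, so the test vectors are transposed as
  well as conjugated. Both operations are invertible, hence positivity survives.\<close>

lemma pform_flip:
  "pform m n y x u v = cnj (pform n m x y (\<lambda>(i, j). cnj (u (j, i))) (\<lambda>(i, j). cnj (v (j, i))))"
  unfolding pform_expand cnj_sum
  by (subst sum.swap, intro sum.cong[OF refl], subst sum.swap) (simp add: cnj_ip)

lemma cpos_mpair_flip: "cpos (idx m n) (mpair ip m n y x) \<longleftrightarrow> cpos (idx n m) (mpair ip n m x y)"
proof -
  have *: "cpos (idx m n) (mpair ip m n y x)" if "cpos (idx n m) (mpair ip n m x y)" for n m x y
    using that unfolding cpos_sform pform_flip[of m n y x] by (simp add: less_eq_complex_def)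
  show ?thesis using * by blast
qed

lemma pform_madj_left:
  assumes "madj st y = y"
  shows "pform n m (madj st x) y u v = cnj (pform n m x y v u)"
proof -
  have y: "y j l = st (y l j)" for j l using fun_cong[OF fun_cong[OF assms, of j], of l] by (simp add: madj_def)
  have "ip (st a) (y j l) = cnj (ip a (y l j))" for a j l by (subst y) (rule ip_st)
  then have "pform n m (madj st x) y u v = (\<Sum>p\<in>idx n m. \<Sum>q\<in>idx n m.
    cnj (cnj (v q) * ip (x (fst q) (fst p)) (y (snd q) (snd p)) * u p))"
    unfolding pform_idx by (intro sum.cong refl) (simp add: madj_def mult_ac)
  also have "\<dots> = cnj (pform n m x y v u)"
    unfolding pform_idx cnj_sum by (rule sum.swap)
  finally show ?thesis .
qed

lemma hermitian_mpair:
  assumes "madj st x = x" "madj st y = y"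
  shows "hermitian_on (idx n m) (mpair ip n m x y)"
proof -
  have x: "x i k = st (x k i)" for i k using fun_cong[OF fun_cong[OF assms(1), of i], of k] by (simp add: madj_def)
  have y: "y j l = st (y l j)" for j l using fun_cong[OF fun_cong[OF assms(2), of j], of l] by (simp add: madj_def)
  have "cnj (ip (x i k) (y j l)) = ip (x k i) (y l j)" for i j k l
    by (subst x, subst y) (simp add: ip_st)
  then show ?thesis by (auto simp: hermitian_on_def mpair_def idx_def)
qed

lemma pform_emat_right:
  "pform n m x (emat e m) u v = (\<Sum>i<n. \<Sum>j<m. \<Sum>k<n. cnj (u (i, j)) * ip (x i k) e * v (k, j))"
  unfolding pform_expand
proof (intro sum.cong refl)
  fix i j k assume "j \<in> {..<m}"
  have "(\<Sum>l<m. cnj (u (i, j)) * ip (x i k) (emat e m j l) * v (k, l))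
      = (\<Sum>l<m. if l = j then cnj (u (i, j)) * ip (x i k) e * v (k, j) else 0)"
    by (intro sum.cong refl) (auto simp: emat_def)
  then show "(\<Sum>l<m. cnj (u (i, j)) * ip (x i k) (emat e m j l) * v (k, l))
      = cnj (u (i, j)) * ip (x i k) e * v (k, j)" using \<open>j \<in> {..<m}\<close> by simp
qed

lemma pform_perp: "(\<And>i j. ip (x i j) e = 0) \<Longrightarrow> pform n m x (emat e m) u v = 0"
  by (simp add: pform_emat_right)

lemma pform_perp_left:
  assumes "\<And>i j. ip (y i j) e = 0"
  shows "pform n m (\<lambda>i j. sm (a i j) e) y u v = 0"
proof -
  have "ip e (y i j) = 0" for i j using assms cnj_ip[of "y i j" e] by simp
  then show ?thesis by (simp add: pform_idx ip_scale_left)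
qed

text \<open>In matrix terms, \<open><<e, y + e>>\<close> is the identity. This makes
  \<open>e\<close> the order unit: adding \<open>r e\<close> to a matrix shifts each of its tested
  values by exactly \<open>r |v|\<^sup>2\<close>.\<close>

lemma pform_emat_unit:
  assumes "\<And>i j. ip (y i j) e = 0"
  shows "pform n m (emat e n) (madd y (emat e m)) v v = complex_of_real ((vnorm (idx n m) v)\<^sup>2)"
proof -
  have "ip e (y i j) = 0" for i j using assms cnj_ip[of "y i j" e] by simp
  then have "pform n m (emat e n) (madd y (emat e m)) v v
      = (\<Sum>p\<in>idx n m. \<Sum>q\<in>idx n m. if q = p then cnj (v p) * v p else 0)"
    unfolding pform_idx
    by (intro sum.cong refl) (auto simp: emat_def madd_def idx_def ip_add_right)
  also have "\<dots> = (\<Sum>p\<in>idx n m. complex_of_real ((cmod (v p))\<^sup>2))"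
    by (intro sum.cong refl) (auto simp: complex_norm_square mult.commute simp del: of_real_power)
  finally show ?thesis unfolding vnorm_power2 by simp
qed

text \<open>A congruence moves onto the test vectors, so invariance of the cone under congruences is
  immediate; with an invertible \<open>a\<close>, positivity can be checked after the
  congruence.\<close>

lemma pform_congr:
  "pform n' m (congr sm n n' a x) y u v
   = pform n m x y (\<lambda>(i, j). \<Sum>k<n'. a i k * u (k, j)) (\<lambda>(i, j). \<Sum>k<n'. a i k * v (k, j))"
proof -
  have "pform n' m (congr sm n n' a x) y u v = (\<Sum>k<n'. \<Sum>j<m. \<Sum>l<n'. \<Sum>j'<m. \<Sum>i<n. \<Sum>i'<n.
      cnj (u (k, j)) * (cnj (a i k) * a i' l * ip (x i i') (y j j')) * v (l, j'))"
    unfolding pform_expand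
    by (intro sum.cong refl) (simp add: congr_def ip_sum_left ip_scale_left sum_distrib_left sum_distrib_right)
  also have "\<dots> = (\<Sum>i<n. \<Sum>j<m. \<Sum>i'<n. \<Sum>j'<m. \<Sum>k<n'. \<Sum>l<n'.
      cnj (u (k, j)) * (cnj (a i k) * a i' l * ip (x i i') (y j j')) * v (l, j'))"
    unfolding sum.cartesian_product
    by (rule sum.reindex_bij_witness[of _ "\<lambda>(i, j, i', j', k, l). (k, j, l, j', i, i')"
          "\<lambda>(k, j, l, j', i, i'). (i, j, i', j', k, l)"]) auto
  also have "\<dots> = pform n m x y (\<lambda>(i, j). \<Sum>k<n'. a i k * u (k, j)) (\<lambda>(i, j). \<Sum>k<n'. a i k * v (k, j))"
    unfolding pform_expand
    by (intro sum.cong refl) (simp add: sum_distrib_left sum_distrib_right mult_ac)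
  finally show ?thesis .
qed

text \<open>This is \<open>a\<^sup>* x c\<close>, the vector of H obtained by compressing the matrix
  \<open>x\<close> between two scalar columns.\<close>

definition contract :: "nat \<Rightarrow> 'h hmat \<Rightarrow> (nat \<Rightarrow> complex) \<Rightarrow> (nat \<Rightarrow> complex) \<Rightarrow> 'h" where
  "contract n x a c = (\<Sum>i<n. \<Sum>k<n. sm (cnj (a i) * c k) (x i k))"

text \<open>With the test vectors read as matrices \<open>A B\<^sup>*\<close> and
  \<open>C D\<^sup>*\<close>, the pairing becomes a sum of inner products of a compression of
  \<open>x\<close> with a compression of \<open>y\<close>. For \<open>y = x\<close>,
  \<open>b = a\<close>, \<open>d = c\<close> it is a sum of squared norms.\<close>

lemma pform_factor:
  "pform n m x y (\<lambda>(i, j). \<Sum>r<N. a r i * cnj (b r j)) (\<lambda>(k, l). \<Sum>s<M. c s k * cnj (d s l))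
   = (\<Sum>r<N. \<Sum>s<M. ip (contract n x (a r) (c s)) (contract m y (b r) (d s)))"
proof -
  have "pform n m x y (\<lambda>(i, j). \<Sum>r<N. a r i * cnj (b r j)) (\<lambda>(k, l). \<Sum>s<M. c s k * cnj (d s l))
    = (\<Sum>i<n. \<Sum>j<m. \<Sum>k<n. \<Sum>l<m. \<Sum>r<N. \<Sum>s<M.
       cnj (a r i) * b r j * ip (x i k) (y j l) * (c s k * cnj (d s l)))"
    unfolding pform_expand
    by (intro sum.cong refl) (simp only: case_prod_conv cnj_sum sum_distrib_right,
        simp only: sum_distrib_left complex_cnj_mult complex_cnj_cnj)
  also have "\<dots> = (\<Sum>r<N. \<Sum>s<M. \<Sum>i<n. \<Sum>k<n. \<Sum>j<m. \<Sum>l<m.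
       cnj (a r i) * b r j * ip (x i k) (y j l) * (c s k * cnj (d s l)))"
    by (rule sum_swap_nested)
  also have "\<dots> = (\<Sum>r<N. \<Sum>s<M. ip (contract n x (a r) (c s)) (contract m y (b r) (d s)))"
    by (intro sum.cong refl)
      (simp only: contract_def ip_sum_left ip_scale_left,
       simp add: ip_sum_right ip_scale_right sum_distrib_left mult_ac)
  finally show ?thesis .
qed

lemma onorm_nonneg: "0 \<le> onorm ip n x"
  by (simp add: onorm_def copnorm_nonneg)

lemma onorm_power2: "(onorm ip n x)\<^sup>2 = copnorm (idx n n) (mpair ip n n x x)"
  by (simp add: onorm_def copnorm_nonneg)

lemma pform_le: "cmod (pform n m x y u v) \<le> onorm ip n x * onorm ip m y * vnorm (idx n m) u * vnorm (idx n m) v"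
proof -
  obtain N a b where ab: "\<And>i j. i < n \<Longrightarrow> j < m \<Longrightarrow> u (i, j) = (\<Sum>r<N. a r i * cnj (b r j))"
    "vnorm (idx n n) (\<lambda>(i, j). \<Sum>r<N::nat. a r i * cnj (a r j)) *
     vnorm (idx m m) (\<lambda>(i, j). \<Sum>r<N. b r i * cnj (b r j)) \<le> (vnorm (idx n m) u)\<^sup>2"
    using hilbert_schmidt_factorization[of n m u] by blast
  obtain M c d where cd: "\<And>i j. i < n \<Longrightarrow> j < m \<Longrightarrow> v (i, j) = (\<Sum>r<M. c r i * cnj (d r j))"
    "vnorm (idx n n) (\<lambda>(i, j). \<Sum>r<M::nat. c r i * cnj (c r j)) *
     vnorm (idx m m) (\<lambda>(i, j). \<Sum>r<M. d r i * cnj (d r j)) \<le> (vnorm (idx n m) v)\<^sup>2"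
    using hilbert_schmidt_factorization[of n m v] by blast
  define P where "P = vnorm (idx n n) (\<lambda>(i, j). \<Sum>r<N. a r i * cnj (a r j))"
  define P' where "P' = vnorm (idx m m) (\<lambda>(i, j). \<Sum>r<N. b r i * cnj (b r j))"
  define R where "R = vnorm (idx n n) (\<lambda>(i, j). \<Sum>r<M. c r i * cnj (c r j))"
  define R' where "R' = vnorm (idx m m) (\<lambda>(i, j). \<Sum>r<M. d r i * cnj (d r j))"
  define X where "X = (\<lambda>(r, s). contract n x (a r) (c s))"
  define Y where "Y = (\<lambda>(r, s). contract m y (b r) (d s))"
  let ?I = "{..<N} \<times> {..<M}"
  have "pform n m x y u v = pform n m x y (\<lambda>(i, j). \<Sum>r<N. a r i * cnj (b r j)) (\<lambda>(k, l). \<Sum>s<M. c s k * cnj (d s l))"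
    by (rule sform_cong) (auto simp: idx_def ab cd)
  also have "\<dots> = (\<Sum>p\<in>?I. ip (X p) (Y p))"
    unfolding pform_factor by (simp add: sum.cartesian_product X_def Y_def case_prod_beta)
  finally have "cmod (pform n m x y u v) \<le> (\<Sum>p\<in>?I. cmod (ip (X p) (Y p)))"
    by (simp add: norm_sum)
  also have "\<dots> \<le> (\<Sum>p\<in>?I. \<bar>hnorm ip (X p)\<bar> * \<bar>hnorm ip (Y p)\<bar>)"
    by (rule sum_mono) (simp add: cauchy_schwarz hnorm_nonneg)
  also have "\<dots> \<le> L2_set (\<lambda>p. hnorm ip (X p)) ?I * L2_set (\<lambda>p. hnorm ip (Y p)) ?I"
    by (rule L2_set_mult_ineq)
  finally have main: "cmod (pform n m x y u v) \<le> L2_set (\<lambda>p. hnorm ip (X p)) ?I * L2_set (\<lambda>p. hnorm ip (Y p)) ?I" .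
  \<comment> \<open>The factor formula read backwards: this sum of squares is a value of
    \<open><<z, z>>\<close> at the test vectors \<open>F F\<^sup>*\<close> and
    \<open>G G\<^sup>*\<close>, so it is bounded by the operator norm that defines
    \<open>onorm\<close>.\<close>
  have L2: "(L2_set (\<lambda>p. hnorm ip ((\<lambda>(r, s). contract k z (f r) (g s)) p)) ?I)\<^sup>2
      \<le> (onorm ip k z)\<^sup>2 * vnorm (idx k k) (\<lambda>(i, j). \<Sum>r<N. f r i * cnj (f r j)) *
        vnorm (idx k k) (\<lambda>(i, j). \<Sum>r<M. g r i * cnj (g r j))" for k z f g
  proof -
    have "(L2_set (\<lambda>p. hnorm ip ((\<lambda>(r, s). contract k z (f r) (g s)) p)) ?I)\<^sup>2
        = (\<Sum>r<N. \<Sum>s<M. (hnorm ip (contract k z (f r) (g s)))\<^sup>2)"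
      by (simp add: L2_set_def sum_nonneg sum.cartesian_product case_prod_beta)
    also have "\<dots> = cmod (\<Sum>r<N. \<Sum>s<M. ip (contract k z (f r) (g s)) (contract k z (f r) (g s)))"
      unfolding ip_self of_real_sum[symmetric] norm_of_real by (simp add: sum_nonneg)
    also have "\<dots> \<le> copnorm (idx k k) (mpair ip k k z z) * vnorm (idx k k) (\<lambda>(i, j). \<Sum>r<N. f r i * cnj (f r j)) *
        vnorm (idx k k) (\<lambda>(i, j). \<Sum>r<M. g r i * cnj (g r j))"
      unfolding pform_factor[symmetric] by (rule sform_le_copnorm) simp
    finally show ?thesis by (simp add: onorm_power2)
  qed
  have "(cmod (pform n m x y u v))\<^sup>2 \<le> (L2_set (\<lambda>p. hnorm ip (X p)) ?I)\<^sup>2 * (L2_set (\<lambda>p. hnorm ip (Y p)) ?I)\<^sup>2"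
    unfolding power_mult_distrib[symmetric] by (rule power_mono[OF main]) simp
  also have "\<dots> \<le> ((onorm ip n x)\<^sup>2 * P * R) * ((onorm ip m y)\<^sup>2 * P' * R')"
    unfolding X_def Y_def P_def P'_def R_def R'_def by (intro mult_mono L2) auto
  \<comment> \<open>Only the products \<open>P * P'\<close> and \<open>R * R'\<close> are controlled
    by the norms of \<open>u\<close> and \<open>v\<close>, so the factors coming from
    \<open>x\<close> and from \<open>y\<close> have to be regrouped.\<close>
  also have "\<dots> = (onorm ip n x)\<^sup>2 * (onorm ip m y)\<^sup>2 * ((P * P') * (R * R'))"
    by simp
  also have "\<dots> \<le> (onorm ip n x)\<^sup>2 * (onorm ip m y)\<^sup>2 * ((vnorm (idx n m) u)\<^sup>2 * (vnorm (idx n m) v)\<^sup>2)"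
    using ab(2) cd(2) unfolding P_def P'_def R_def R'_def by (intro mult_left_mono mult_mono) auto
  also have "\<dots> = (onorm ip n x * onorm ip m y * vnorm (idx n m) u * vnorm (idx n m) v)\<^sup>2"
    by (simp add: power_mult_distrib)
  finally show ?thesis by (rule power2_le_imp_le) (simp add: onorm_nonneg)
qed

lemma copnorm_mpair_le: "copnorm (idx n m) (mpair ip n m x y) \<le> onorm ip n x * onorm ip m y"
  by (rule copnorm_leI) (auto simp: onorm_nonneg pform_le)

subsection \<open>The cone and its dual\<close>

lemma herm_iff: "herm st n x \<longleftrightarrow> in_mat n x \<and> (\<forall>i j. st (x j i) = x i j)"
  by (auto simp: herm_def madj_def fun_eq_iff)

lemma herm_madj: "herm st n x \<Longrightarrow> madj st x = x"
  by (simp add: herm_def)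

lemma herm_madd: "herm st n x \<Longrightarrow> herm st n y \<Longrightarrow> herm st n (madd x y)"
  by (simp add: herm_iff in_mat_def madd_def st_add)

lemma herm_mscale: "herm st n x \<Longrightarrow> herm st n (mscale sm r x)"
  by (simp add: herm_iff in_mat_def mscale_def st_scale)

lemma herm_emat: "herm st n (emat e n)"
  by (auto simp: herm_iff in_mat_def emat_def)

lemma herm_zero: "herm st n (\<lambda>i j. 0)"
  by (simp add: herm_iff in_mat_def)

lemma herm_congr:
  assumes "herm st n x"
  shows "herm st m (congr sm n m a x)"
proof -
  have "st (\<Sum>i<n. \<Sum>j<n. sm (cnj (a i l) * a j k) (x i j))
      = (\<Sum>i<n. \<Sum>j<n. sm (cnj (a i k) * a j l) (x i j))" for k l
    unfolding st_sum by (subst sum.swap) (use assms in \<open>simp add: st_scale herm_iff mult.commute\<close>)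
  then show ?thesis by (simp add: herm_iff in_mat_def congr_def)
qed

lemma pform_mscale_left: "pform n m (mscale sm r x) y u v = complex_of_real r * pform n m x y u v"
  unfolding mscale_def by (rule pform_scale_left)

lemma pform_mscale_right: "pform n m x (mscale sm r y) u v = complex_of_real r * pform n m x y u v"
  unfolding mscale_def by (simp add: pform_scale_right)

lemma Bset_iff: "y \<in> Bset ip st e n \<longleftrightarrow> herm st n y \<and> (\<forall>i j. ip (y i j) e = 0) \<and> onorm ip n y \<le> 1"
  by (simp add: Bset_def)

lemma onorm_mscale_le: "onorm ip n (mscale sm r x) \<le> \<bar>r\<bar> * onorm ip n x"
proof -
  have "copnorm (idx n n) (mpair ip n n (mscale sm r x) (mscale sm r x)) \<le> (\<bar>r\<bar> * onorm ip n x)\<^sup>2"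
  proof (rule copnorm_leI)
    fix u v
    have "cmod (pform n n (mscale sm r x) (mscale sm r x) u v) = \<bar>r\<bar> * \<bar>r\<bar> * cmod (pform n n x x u v)"
      by (simp add: pform_mscale_left pform_mscale_right norm_mult)
    also have "\<dots> \<le> \<bar>r\<bar> * \<bar>r\<bar> * (onorm ip n x * onorm ip n x * vnorm (idx n n) u * vnorm (idx n n) v)"
      by (intro mult_left_mono pform_le) simp
    finally show "cmod (pform n n (mscale sm r x) (mscale sm r x) u v)
        \<le> (\<bar>r\<bar> * onorm ip n x)\<^sup>2 * vnorm (idx n n) u * vnorm (idx n n) v"
      by (simp add: power2_eq_square mult_ac)
  qed simp
  then show ?thesis
    unfolding onorm_power2[symmetric] by (rule power2_le_imp_le) (simp add: onorm_nonneg)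
qed

lemma mscale_in_Bset:
  assumes "herm st n y" "\<And>i j. ip (y i j) e = 0" "\<bar>r\<bar> * onorm ip n y \<le> 1"
  shows "mscale sm r y \<in> Bset ip st e n"
  unfolding Bset_iff using assms(1,2) order_trans[OF onorm_mscale_le assms(3)]
  by (simp add: herm_mscale) (simp add: mscale_def ip_scale_left)

lemma zero_in_Bset: "(\<lambda>i j. 0) \<in> Bset ip st e n"
proof -
  have "copnorm (idx n n) (mpair ip n n (\<lambda>i j. 0) (\<lambda>i j. 0)) \<le> 0"
    by (rule copnorm_leI) (auto simp: pform_idx)
  then have "onorm ip n (\<lambda>i j. 0) \<le> 1" by (simp add: onorm_def)
  then show ?thesis by (simp add: Bset_iff herm_zero)
qed

lemma madd_zero: "madd (\<lambda>i j. 0) x = (x :: 'h hmat)"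
  by (simp add: madd_def)

lemma herm_unit: "y \<in> Bset ip st e m \<Longrightarrow> herm st m (madd y (emat e m))"
  by (simp add: Bset_iff herm_madd herm_emat)

lemma cpos_mpair_iff:
  "herm st n x \<Longrightarrow> herm st m y \<Longrightarrow>
    cpos (idx n m) (mpair ip n m x y) \<longleftrightarrow> (\<forall>v. 0 \<le> Re (pform n m x y v v))"
  by (intro cpos_hermitian hermitian_mpair herm_madj)

lemma Co_iff: "z \<in> Co ip st e n \<longleftrightarrow> herm st n z \<and>
    (\<forall>m. \<forall>y\<in>Bset ip st e m. \<forall>v. 0 \<le> Re (pform n m z (madd y (emat e m)) v v))"
  unfolding Co_def using cpos_mpair_iff[OF _ herm_unit] by blast

lemma CoD: "z \<in> Co ip st e n \<Longrightarrow> y \<in> Bset ip st e m \<Longrightarrow> 0 \<le> Re (pform n m z (madd y (emat e m)) v v)"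
  by (simp add: Co_iff)

lemma Co_herm: "z \<in> Co ip st e n \<Longrightarrow> herm st n z"
  by (simp add: Co_iff)

lemma Cobar_eq_Co: "Cobar ip st e = Co ip st e"
  by (intro ext) (simp add: Co_def Cobar_def cpos_mpair_flip)

lemma pform_emat_Bset:
  "y \<in> Bset ip st e m \<Longrightarrow> pform n m (emat e n) (madd y (emat e m)) v v = complex_of_real ((vnorm (idx n m) v)\<^sup>2)"
  by (rule pform_emat_unit) (simp add: Bset_iff)

text \<open>Orthogonality to \<open>e\<close> kills both cross terms:
  \<open><<x + e, y + e>>\<close> is \<open><<x, y>>\<close> plus the identity.\<close>

lemma pform_unit_Bset:
  assumes "y \<in> Bset ip st e m" "\<And>i j. ip (x i j) e = 0"
  shows "pform n m (madd x (emat e n)) (madd y (emat e m)) v v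
    = pform n m x y v v + complex_of_real ((vnorm (idx n m) v)\<^sup>2)"
  unfolding pform_madd_left pform_emat_Bset[OF assms(1)]
  unfolding pform_madd_right using pform_perp[of x n m, OF assms(2)] by simp

lemma pform_Bset_le:
  assumes "x \<in> Bset ip st e n" "y \<in> Bset ip st e m"
  shows "\<bar>Re (pform n m x y v v)\<bar> \<le> (vnorm (idx n m) v)\<^sup>2"
proof -
  have "\<bar>Re (pform n m x y v v)\<bar> \<le> onorm ip n x * onorm ip m y * (vnorm (idx n m) v)\<^sup>2"
    using order_trans[OF abs_Re_le_cmod pform_le] by (simp add: power2_eq_square mult.assoc)
  also have "\<dots> \<le> 1 * (vnorm (idx n m) v)\<^sup>2"
    using assms by (intro mult_right_mono mult_le_one) (auto simp: Bset_iff onorm_nonneg)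
  finally show ?thesis by simp
qed

lemma unit_in_Co:
  assumes "y \<in> Bset ip st e n"
  shows "madd y (emat e n) \<in> Co ip st e n"
  unfolding Co_iff
proof (intro conjI allI ballI)
  fix m x v assume "x \<in> Bset ip st e m"
  then show "0 \<le> Re (pform n m (madd y (emat e n)) (madd x (emat e m)) v v)"
    using pform_Bset_le[OF assms, of x m v] pform_unit_Bset[of x m y n v] assms
    by (simp add: Bset_iff)
qed (rule herm_unit[OF assms])

text \<open>Testing against \<open>\<plusminus> y / \<parallel>y\<parallel>\<^sub>o\<close> bounds \<open>\<parallel>y\<parallel>\<^sub>o\<close>.\<close>

lemma Bset_if_unit_in_Co:
  assumes y: "herm st n y" "\<And>i j. ip (y i j) e = 0" "madd y (emat e n) \<in> Co ip st e n"
  shows "y \<in> Bset ip st e n"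
proof (cases "onorm ip n y = 0")
  case True
  then show ?thesis using y by (simp add: Bset_iff)
next
  case False
  define s where "s = onorm ip n y"
  have s: "s > 0" using False onorm_nonneg[of n y] by (simp add: s_def)
  have *: "0 \<le> r * Re (pform n n y y v v) + (vnorm (idx n n) v)\<^sup>2" if "\<bar>r\<bar> = 1 / s" for r v
  proof -
    have B: "mscale sm r y \<in> Bset ip st e n"
      by (rule mscale_in_Bset) (use y that s in \<open>auto simp: s_def[symmetric]\<close>)
    show ?thesis
      using CoD[OF y(3) B, where v = v] pform_unit_Bset[OF B y(2), where v = v] by (simp add: pform_mscale_right)
  qed
  have "copnorm (idx n n) (mpair ip n n y y) \<le> s"
  proof (rule copnorm_le_hermitian)
    fix v
    have "\<bar>Re (pform n n y y v v)\<bar> / s \<le> (vnorm (idx n n) v)\<^sup>2"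
      using *[of "1 / s" v] *[of "- (1 / s)" v] s by (simp add: abs_if)
    then show "\<bar>Re (pform n n y y v v)\<bar> \<le> s * (vnorm (idx n n) v)\<^sup>2"
      using s by (simp add: divide_le_eq mult.commute)
  qed (use s y in \<open>auto intro: hermitian_mpair herm_madj\<close>)
  \<comment> \<open>The left-hand side is quadratic because \<open>onorm\<close> is a square root of
    an operator norm, whereas the test against \<open>y / s\<close> is linear in
    \<open>1 / s\<close>.\<close>
  then have "s * s \<le> s * 1" unfolding onorm_power2[symmetric] s_def[symmetric] by (simp add: power2_eq_square)
  then have "s \<le> 1" using s by simp
  then show ?thesis using y by (simp add: Bset_iff s_def)
qed

lemma Co_madd: "x \<in> Co ip st e n \<Longrightarrow> y \<in> Co ip st e n \<Longrightarrow> madd x y \<in> Co ip st e n"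
  by (simp add: Co_iff herm_madd pform_madd_left)

lemma Co_mscale: "x \<in> Co ip st e n \<Longrightarrow> 0 \<le> r \<Longrightarrow> mscale sm r x \<in> Co ip st e n"
  by (simp add: Co_iff herm_mscale pform_mscale_left)

lemma Co_congr: "x \<in> Co ip st e n \<Longrightarrow> congr sm n m a x \<in> Co ip st e m"
  by (simp add: Co_iff herm_congr pform_congr)

lemma zero_in_Co: "(\<lambda>i j. 0) \<in> Co ip st e n"
  by (simp add: Co_iff herm_zero pform_idx)

lemma emat_in_Co: "emat e n \<in> Co ip st e n"
  using unit_in_Co[OF zero_in_Bset] by (simp add: madd_zero)

lemma quantum_cone_Co: "quantum_cone sm st (Co ip st e)"
  unfolding quantum_cone_def by (auto simp: Co_madd Co_congr Co_herm)

section \<open>The matrix order unit and the Archimedean property\<close>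

lemma onorm_unit_le:
  assumes "y \<in> Bset ip st e m"
  shows "onorm ip m (madd y (emat e m)) \<le> 2"
proof -
  have "copnorm (idx m m) (mpair ip m m (madd y (emat e m)) (madd y (emat e m))) \<le> 2"
  proof (rule copnorm_le_hermitian)
    fix v
    have "pform m m (madd y (emat e m)) (madd y (emat e m)) v v
        = pform m m y y v v + complex_of_real ((vnorm (idx m m) v)\<^sup>2)"
      by (rule pform_unit_Bset[OF assms]) (use assms in \<open>simp add: Bset_iff\<close>)
    then show "\<bar>Re (pform m m (madd y (emat e m)) (madd y (emat e m)) v v)\<bar> \<le> 2 * (vnorm (idx m m) v)\<^sup>2"
      using pform_Bset_le[OF assms assms, of v] by simp
  qed (auto intro!: hermitian_mpair herm_madj herm_unit assms)
  \<comment> \<open>The argument yields the square root of 2; the weaker bound 2 is what gives the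
    factor 1/2 in the comparison of norms.\<close>
  then have "(onorm ip m (madd y (emat e m)))\<^sup>2 \<le> 2\<^sup>2"
    unfolding onorm_power2 by simp
  then show ?thesis by (rule power2_le_imp_le) simp
qed

lemma copnorm_unit_le:
  assumes "y \<in> Bset ip st e m"
  shows "copnorm (idx n m) (mpair ip n m x (madd y (emat e m))) \<le> 2 * onorm ip n x"
  using order_trans[OF copnorm_mpair_le mult_left_mono[OF onorm_unit_le[OF assms] onorm_nonneg]]
  by (simp add: mult.commute)

lemma unital_Co: "unital_qcone sm st e (Co ip st e)"
  unfolding unital_qcone_def
proof (intro allI impI)
  fix n x assume x: "herm st n x"
  \<comment> \<open>The term \<open>2 * onorm ip n x\<close> dominates every pairing of
    \<open>x\<close> with some \<open>y + e\<close>; the added 1 keeps \<open>r\<close> positive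
    when \<open>x\<close> has norm 0.\<close>
  define r where "r = 2 * onorm ip n x + 1"
  have "r > 0" using onorm_nonneg[of n x] by (simp add: r_def)
  moreover have "madd x (mscale sm r (emat e n)) \<in> Co ip st e n"
    unfolding Co_iff
  proof (intro conjI allI ballI)
    fix m y v assume y: "y \<in> Bset ip st e m"
    have "\<bar>Re (pform n m x (madd y (emat e m)) v v)\<bar>
        \<le> copnorm (idx n m) (mpair ip n m x (madd y (emat e m))) * vnorm (idx n m) v * vnorm (idx n m) v"
      by (rule order_trans[OF abs_Re_le_cmod sform_le_copnorm]) simp
    also have "\<dots> = copnorm (idx n m) (mpair ip n m x (madd y (emat e m))) * (vnorm (idx n m) v)\<^sup>2"
      by (simp add: power2_eq_square)
    also have "\<dots> \<le> r * (vnorm (idx n m) v)\<^sup>2"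
      using copnorm_unit_le[OF y, of n x] by (intro mult_right_mono) (auto simp: r_def)
    finally show "0 \<le> Re (pform n m (madd x (mscale sm r (emat e n))) (madd y (emat e m)) v v)"
      unfolding pform_madd_left pform_mscale_left pform_emat_Bset[OF y] by simp
  qed (simp add: herm_madd herm_mscale herm_emat x)
  ultimately show "\<exists>r>0. madd x (mscale sm r (emat e n)) \<in> Co ip st e n" by blast
qed

lemma archimedean_Co: "archimedean_qcone sm st e (Co ip st e)"
  unfolding archimedean_qcone_def
proof (intro allI impI)
  fix n x assume x: "herm st n x" and *: "\<forall>r>0. madd x (mscale sm r (emat e n)) \<in> Co ip st e n"
  show "x \<in> Co ip st e n"
    unfolding Co_iff
  proof (intro conjI allI ballI x)
    fix m y v assume y: "y \<in> Bset ip st e m"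
    let ?c = "Re (pform n m x (madd y (emat e m)) v v)" and ?N = "(vnorm (idx n m) v)\<^sup>2"
    have "0 \<le> ?c + \<epsilon>" if "\<epsilon> > 0" for \<epsilon>
    proof -
      define r where "r = \<epsilon> / (?N + 1)"
      have N: "?N + 1 > 0" by (simp add: add_nonneg_pos)
      then have r: "r > 0" using that by (simp add: r_def)
      then have "0 \<le> ?c + r * ?N"
        using CoD[OF _ y, of "madd x (mscale sm r (emat e n))" n v] *
        unfolding pform_madd_left pform_mscale_left pform_emat_Bset[OF y] by simp
      also have "r * ?N \<le> r * (?N + 1)" using r by simp
      also have "\<dots> = \<epsilon>" using N by (simp add: r_def)
      finally show ?thesis by simp
    qed
    then show "0 \<le> ?c" by (rule field_le_epsilon)
  qed
qed

text \<open>Subtracting the unit leaves a matrix orthogonal to \<open>e\<close>, to which the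
  converse \<open>Bset_if_unit_in_Co\<close> applies. It identifies the matricial states as well as
  the cone elements normalized by a congruence.\<close>

lemma Co_normalized:
  assumes "q \<in> Co ip st e n" "\<And>i j. i < n \<Longrightarrow> j < n \<Longrightarrow> ip (q i j) e = (if i = j then 1 else 0)"
  shows "\<exists>y \<in> Bset ip st e n. q = madd y (emat e n)"
proof -
  define y where "y i j = q i j - emat e n i j" for i j
  have q: "q = madd y (emat e n)" by (simp add: y_def madd_def)
  have "herm st n y"
    using Co_herm[OF assms(1)] herm_emat[of n] by (auto simp: herm_iff in_mat_def y_def st_diff)
  moreover have "ip (y i j) e = 0" for i j
    using Co_herm[OF assms(1)] assms(2) by (cases "i < n \<and> j < n") (auto simp: y_def ip_diff_left emat_def herm_iff in_mat_def)
  ultimately have "y \<in> Bset ip st e n"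
    using Bset_if_unit_in_Co assms(1) q by blast
  with q show ?thesis by blast
qed

text \<open>Adding \<open>\<epsilon> e\<close> makes the \<open>e\<close>-component of \<open>z\<close> positive definite, and congruence with
  its inverse square root turns \<open>z + \<epsilon> e\<close> into one of the units \<open>y + e\<close> that define the cone.\<close>

lemma Co_pform_nonneg_eps:
  assumes z: "z \<in> Co ip st e n" and x: "x \<in> Co ip st e m" and "\<epsilon> > 0"
  shows "0 \<le> Re (pform n m (madd z (mscale sm \<epsilon> (emat e n))) x v v)"
proof -
  define z' where "z' = madd z (mscale sm \<epsilon> (emat e n))"
  have z': "z' \<in> Co ip st e n"
    unfolding z'_def by (intro Co_madd Co_mscale z emat_in_Co) (use assms in simp)
  define a where "a i j = ip (z' i j) e" for i j
  have "a j i = cnj (a i j)" for i j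
    using Co_herm[OF z'] by (metis a_def herm_iff ip_st_e)
  then obtain W l where W: "funitary n W" and
    l: "fm_eq n a (fmult n W (fmult n (fdiag (\<lambda>r. complex_of_real (l r))) (fadj W)))"
    using hermitian_spectral[of n a] by metis
  let ?D = "\<lambda>f. fdiag (\<lambda>r. complex_of_real (f r))"
  have W1: "fm_eq n (fmult n (fadj W) W) (fdiag (\<lambda>_. 1))" "fm_eq n (fmult n W (fadj W)) (fdiag (\<lambda>_. 1))"
    using W by (auto simp: funitary_def)
  have WaW: "fm_eq n (fmult n (fadj W) (fmult n a W)) (?D l)"
  proof -
    have "fm_eq n (fmult n (fadj W) (fmult n a W)) (fmult n (fadj W) (fmult n W (fmult n (?D l) (fmult n (fadj W) W))))"
      using fm_eq_fmult[OF fm_eq_refl fm_eq_fmult[OF l fm_eq_refl], of "fadj W" W] by (simp add: fmult_assoc)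
    also have "fm_eq n \<dots> (fmult n (?D l) (fmult n (fadj W) W))" by (rule fmult_cancel[OF W1(1)])
    also have "fm_eq n \<dots> (fmult n (?D l) (fdiag (\<lambda>_. 1)))" by (intro fm_eq_fmult fm_eq_refl W1)
    also have "fm_eq n \<dots> (?D l)" by (rule fmult_one)
    finally show ?thesis .
  qed
  \<comment> \<open>The eigenvector in column \<open>r\<close> of \<open>W\<close> serves as test
    vector against \<open>e\<close> alone, that is, against the element 0 of the unit ball with
    \<open>m = 1\<close>. Membership of \<open>z\<close> in the cone then gives
    \<open>l r \<ge> \<epsilon>\<close>.\<close>
  have lpos: "l r > 0" if "r < n" for r
  proof -
    let ?w = "\<lambda>(i::nat, j::nat). W i r"
    have "complex_of_real (l r) = fmult n (fadj W) (fmult n a W) r r"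
      using WaW that by (simp add: fm_eq_def fdiag_def)
    also have "\<dots> = pform n 1 z' (emat e 1) ?w ?w"
      unfolding pform_emat_right by (simp add: fmult_def fadj_def a_def sum_distrib_left mult.assoc)
    finally have "l r = Re (pform n 1 z' (emat e 1) ?w ?w)" by (metis Re_complex_of_real)
    also have "\<dots> \<ge> \<epsilon> * (vnorm (idx n 1) ?w)\<^sup>2"
      using CoD[OF z zero_in_Bset, of 1 ?w] pform_emat_Bset[OF zero_in_Bset, of n 1 ?w]
      unfolding z'_def pform_madd_left pform_mscale_left by (simp add: madd_zero)
    finally have "l r \<ge> \<epsilon> * (vnorm (idx n 1) ?w)\<^sup>2" .
    moreover have "complex_of_real ((vnorm (idx n 1) ?w)\<^sup>2) = fmult n (fadj W) W r r"
      unfolding vnorm_idx by (simp add: fmult_def fadj_def complex_norm_square mult.commute del: of_real_power)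
    then have "(vnorm (idx n 1) ?w)\<^sup>2 = 1"
      using W1(1) that unfolding fm_eq_def fdiag_def by (metis of_real_eq_1_iff)
    ultimately show ?thesis using \<open>\<epsilon> > 0\<close> by simp
  qed
  have DD: "fm_eq n (fmult n (?D f) (?D g)) (?D (\<lambda>r. f r * g r))" for f g
    by (auto simp: fm_eq_def fmult_def fdiag_def if_distrib[of "\<lambda>x. x * _"] cong: if_cong)
  have D1: "fm_eq n (?D f) (fdiag (\<lambda>_. 1))" if "\<And>r. r < n \<Longrightarrow> f r = 1" for f
    using that by (auto simp: fm_eq_def fdiag_def)
  define s where "s r = 1 / sqrt (l r)" for r
  \<comment> \<open>Only \<open>g\<^sup>* a g = 1\<close> and invertibility are required, so
    \<open>g\<close> is the inverse square root of \<open>a\<close> without its trailing unitary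
    factor \<open>W\<^sup>*\<close>; \<open>h\<close> is the inverse of \<open>g\<close>.\<close>
  define g where "g = fmult n W (?D s)"
  define h where "h = fmult n (?D (\<lambda>r. sqrt (l r))) (fadj W)"
  have gh: "fm_eq n (fmult n g h) (fdiag (\<lambda>_. 1))"
  proof -
    have "fm_eq n (fmult n (?D s) (?D (\<lambda>r. sqrt (l r)))) (fdiag (\<lambda>_. 1))"
      by (rule fm_eq_trans[OF DD D1]) (use lpos in \<open>auto simp: s_def\<close>, use lpos in force)
    then have "fm_eq n (fmult n (?D s) (fmult n (?D (\<lambda>r. sqrt (l r))) (fadj W))) (fadj W)"
      by (rule fmult_cancel)
    then have "fm_eq n (fmult n W (fmult n (?D s) (fmult n (?D (\<lambda>r. sqrt (l r))) (fadj W)))) (fmult n W (fadj W))"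
      by (intro fm_eq_fmult fm_eq_refl)
    then show ?thesis using W1(2) fm_eq_trans unfolding g_def h_def fmult_assoc by blast
  qed
  have gag: "fm_eq n (fmult n (fadj g) (fmult n a g)) (fdiag (\<lambda>_. 1))"
  proof -
    have "fadj (?D s) = ?D s" by (auto simp: fadj_def fdiag_def fun_eq_iff)
    then have eq: "fmult n (fadj g) (fmult n a g)
        = fmult n (?D s) (fmult n (fmult n (fadj W) (fmult n a W)) (?D s))"
      by (simp add: g_def fadj_fmult fmult_assoc)
    have "fm_eq n (fmult n (fadj g) (fmult n a g)) (fmult n (?D s) (fmult n (?D l) (?D s)))"
      unfolding eq by (intro fm_eq_fmult fm_eq_refl WaW)
    also have "fm_eq n \<dots> (fmult n (?D s) (?D (\<lambda>r. l r * s r)))"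
      by (rule fm_eq_fmult[OF fm_eq_refl DD])
    also have "fm_eq n \<dots> (?D (\<lambda>r. s r * (l r * s r)))" by (rule DD)
    also have "fm_eq n \<dots> (fdiag (\<lambda>_. 1))"
    proof (rule D1)
      fix r assume "r < n"
      then have "l r > 0" by (rule lpos)
      then show "s r * (l r * s r) = 1" by (simp add: s_def)
    qed
    finally show ?thesis .
  qed
  define q where "q = congr sm n n g z'"
  have q: "q \<in> Co ip st e n" unfolding q_def by (rule Co_congr[OF z'])
  have "\<exists>y \<in> Bset ip st e n. q = madd y (emat e n)"
  proof (rule Co_normalized[OF q])
    fix i j assume ij: "i < n" "j < n"
    have "ip (q i j) e = fmult n (fadj g) (fmult n a g) i j"
      using ij by (simp add: q_def congr_def ip_sum_left ip_scale_left fmult_def fadj_def a_def sum_distrib_left mult_ac)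
    then show "ip (q i j) e = (if i = j then 1 else 0)"
      using gag ij by (simp add: fm_eq_def fdiag_def)
  qed
  then obtain y where y: "y \<in> Bset ip st e n" "q = madd y (emat e n)" by blast
  \<comment> \<open>The choice \<open>w = h v\<close> gives \<open>g w = v\<close>, so the value of
    \<open>q = g\<^sup>* z' g\<close> at \<open>w\<close> is the value of \<open>z'\<close> at
    \<open>v\<close>. Since \<open>q\<close> is a unit \<open>y + e\<close>, the former is
    nonnegative because \<open>x\<close> lies in the cone; the flip is needed as \<open>CoD\<close>
    has the cone element in the first slot.\<close>
  define w where "w = (\<lambda>(r, j). \<Sum>k<n. h r k * v (k, j))"
  have "0 \<le> Re (pform m n x q (\<lambda>(i, j). cnj (w (j, i))) (\<lambda>(i, j). cnj (w (j, i))))"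
    unfolding y(2) by (rule CoD[OF x y(1)])
  then have "0 \<le> Re (pform n m q x w w)"
    by (subst pform_flip) simp
  also have "pform n m q x w w = pform n m z' x v v"
  proof -
    have "(case p of (i, j) \<Rightarrow> \<Sum>k<n. g i k * w (k, j)) = v p" if p_in: "p \<in> idx n m" for p
    proof -
      obtain i j where p: "p = (i, j)" "i < n" using p_in by (auto simp: idx_def)
      have "(\<Sum>r<n. g i r * w (r, j)) = (\<Sum>r<n. \<Sum>k<n. g i r * h r k * v (k, j))"
        by (simp add: w_def sum_distrib_left mult.assoc)
      also have "\<dots> = (\<Sum>k<n. fmult n g h i k * v (k, j))"
        by (subst sum.swap) (simp add: fmult_def sum_distrib_right)
      also have "\<dots> = (\<Sum>k<n. if k = i then v (k, j) else 0)"
        using gh p by (intro sum.cong) (auto simp: fm_eq_def fdiag_def)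
      also have "\<dots> = v p" using p by simp
      finally show ?thesis by (simp add: p)
    qed
    then show ?thesis unfolding q_def pform_congr by (intro sform_cong refl)
  qed
  finally show ?thesis by (simp add: z'_def)
qed

text \<open>The perturbed form is affine in the perturbation parameter, so its nonnegativity passes
  to the limit 0.\<close>

lemma Co_cpos:
  assumes z: "z \<in> Co ip st e n" and x: "x \<in> Co ip st e m"
  shows "cpos (idx n m) (mpair ip n m z x)"
  unfolding cpos_hermitian[OF hermitian_mpair[OF herm_madj[OF Co_herm[OF z]] herm_madj[OF Co_herm[OF x]]]]
proof
  fix v
  let ?c = "Re (pform n m z x v v)" and ?d = "Re (pform n m (emat e n) x v v)"
  have "0 \<le> ?c + \<epsilon>" if "\<epsilon> > 0" for \<epsilon>
  proof -
    define r where "r = \<epsilon> / (\<bar>?d\<bar> + 1)"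
    have r: "r > 0" using that by (simp add: r_def)
    have "0 \<le> ?c + r * ?d"
      using Co_pform_nonneg_eps[OF z x r, of v] by (simp add: pform_madd_left pform_mscale_left)
    also have "r * ?d \<le> r * (\<bar>?d\<bar> + 1)" using r by (intro mult_left_mono) auto
    also have "\<dots> = \<epsilon>" using add_nonneg_pos[of "\<bar>?d\<bar>" 1] by (simp add: r_def)
    finally show ?thesis by simp
  qed
  then show "0 \<le> ?c" by (rule field_le_epsilon)
qed

text \<open>All units \<open>y + e\<close> belong to the cone, so its polar satisfies the conditions
  defining \<open>Cobar\<close>; the other inclusion is positivity of the pairing on the
  cone.\<close>

lemma polarH_Co: "polarH ip st (Co ip st e) = Co ip st e"
proof (intro ext equalityI subsetI)
  fix n x assume x: "x \<in> polarH ip st (Co ip st e) n"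
  have "x \<in> Cobar ip st e n" using x unit_in_Co by (auto simp: polarH_def Cobar_def)
  then show "x \<in> Co ip st e n" by (simp add: Cobar_eq_Co)
next
  fix n x assume x: "x \<in> Co ip st e n"
  then show "x \<in> polarH ip st (Co ip st e) n"
    using Co_cpos Co_herm by (auto simp: polarH_def)
qed

lemma polarHbar_Co: "polarHbar ip st (Co ip st e) = Co ip st e"
proof -
  have "polarHbar ip st (Co ip st e) = polarH ip st (Co ip st e)"
    by (intro ext) (simp add: polarHbar_def polarH_def cpos_mpair_flip)
  then show ?thesis by (simp add: polarH_Co)
qed

lemma states_Co:
  "{x \<in> polarH ip st (Co ip st e) n. mpair ip 1 n (emat e 1) x = cmat_id (idx 1 n)}
     = {madd y (emat e n) | y. y \<in> Bset ip st e n}"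
proof (intro equalityI subsetI)
  fix x assume "x \<in> {x \<in> polarH ip st (Co ip st e) n. mpair ip 1 n (emat e 1) x = cmat_id (idx 1 n)}"
  then have x: "x \<in> Co ip st e n" and id: "mpair ip 1 n (emat e 1) x = cmat_id (idx 1 n)"
    by (auto simp: polarH_Co)
  have "\<exists>y \<in> Bset ip st e n. x = madd y (emat e n)"
  proof (rule Co_normalized[OF x])
    fix i j assume ij: "i < n" "j < n"
    have "ip e (x i j) = (if i = j then 1 else 0)"
      using fun_cong[OF fun_cong[OF id, of "(0, i)"], of "(0, j)"] ij
      by (simp add: mpair_def emat_def cmat_id_def idx_def)
    then show "ip (x i j) e = (if i = j then 1 else 0)"
      using cnj_ip[of e "x i j"] by (auto split: if_splits)
  qed
  then show "x \<in> {madd y (emat e n) | y. y \<in> Bset ip st e n}" by blast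
next
  fix x assume "x \<in> {madd y (emat e n) | y. y \<in> Bset ip st e n}"
  then obtain y where y: "y \<in> Bset ip st e n" and x: "x = madd y (emat e n)" by blast
  have "ip e (y i j) = 0" for i j using y cnj_ip[of "y i j" e] by (simp add: Bset_iff)
  then have "mpair ip 1 n (emat e 1) x = cmat_id (idx 1 n)"
    by (auto simp: x fun_eq_iff mpair_def emat_def madd_def cmat_id_def idx_def ip_add_right)
  then show "x \<in> {x \<in> polarH ip st (Co ip st e) n. mpair ip 1 n (emat e 1) x = cmat_id (idx 1 n)}"
    using unit_in_Co[OF y] by (simp add: polarH_Co x)
qed

subsection \<open>Norms and the scalar cone\<close>

lemma pform_block2:
  "pform (2 * n) m (block2 n A B C D) y v v
   = pform n m A y v v + pform n m B y v (\<lambda>(i, j). v (n + i, j))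
   + pform n m C y (\<lambda>(i, j). v (n + i, j)) v + pform n m D y (\<lambda>(i, j). v (n + i, j)) (\<lambda>(i, j). v (n + i, j))"
  unfolding pform_expand mult_2 sum_lessThan_add
  by (simp add: block2_def sum.distrib)

lemma herm_block2:
  assumes "in_mat n z"
  shows "herm st (2 * n) (block2 n (mscale sm r (emat e n)) z (madj st z) (mscale sm r (emat e n)))"
  using assms by (auto simp: herm_iff in_mat_def block2_def madj_def mscale_def emat_def st_scale)

text \<open>The usual 2 by 2 block criterion for a norm bound, applied separately for each unit
  \<open>y + e\<close>: on a test vector with halves \<open>v\<close> and \<open>w\<close> the form
  is \<open>r (|v|\<^sup>2 + |w|\<^sup>2)\<close> plus twice the real part of the form of
  \<open>z\<close> at \<open>v\<close> and \<open>w\<close>.\<close>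

lemma block2_in_Co_iff:
  assumes "in_mat n z" "0 < r"
  shows "block2 n (mscale sm r (emat e n)) z (madj st z) (mscale sm r (emat e n)) \<in> Co ip st e (2 * n)
    \<longleftrightarrow> (\<forall>m. \<forall>y\<in>Bset ip st e m. copnorm (idx n m) (mpair ip n m z (madd y (emat e m))) \<le> r)"
proof -
  let ?b = "block2 n (mscale sm r (emat e n)) z (madj st z) (mscale sm r (emat e n))"
  have block: "Re (pform (2 * n) m ?b (madd y (emat e m)) v v)
      = r * ((vnorm (idx n m) v)\<^sup>2 + (vnorm (idx n m) (\<lambda>(i, j). v (n + i, j)))\<^sup>2)
        + 2 * Re (pform n m z (madd y (emat e m)) v (\<lambda>(i, j). v (n + i, j)))"
    if y: "y \<in> Bset ip st e m" for m y and v :: "nat \<times> nat \<Rightarrow> complex"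
    unfolding pform_block2 pform_mscale_left pform_emat_Bset[OF y]
      pform_madj_left[OF herm_madj[OF herm_unit[OF y]]]
    by (simp add: algebra_simps)
  have "(\<forall>v. 0 \<le> Re (pform (2 * n) m ?b (madd y (emat e m)) v v))
      \<longleftrightarrow> copnorm (idx n m) (mpair ip n m z (madd y (emat e m))) \<le> r"
    if y: "y \<in> Bset ip st e m" for m y
  proof
    assume *: "\<forall>v. 0 \<le> Re (pform (2 * n) m ?b (madd y (emat e m)) v v)"
    show "copnorm (idx n m) (mpair ip n m z (madd y (emat e m))) \<le> r"
    proof (rule copnorm_le_Re)
      fix u w :: "nat \<times> nat \<Rightarrow> complex"
      \<comment> \<open>The sign in the upper half turns nonnegativity of the block form into an
        upper bound for the mixed term.\<close>
      define v where "v = (\<lambda>(i, j). if i < n then (-1) * u (i, j) else w (i - n, j))"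
      have v1: "vnorm (idx n m) v = vnorm (idx n m) u"
        using vnorm_scale[of "idx n m" "-1" u] vnorm_cong[of "idx n m" v "\<lambda>p. (-1) * u p"]
        by (auto simp: v_def idx_def)
      have v2: "(\<lambda>(i, j). v (n + i, j)) = w"
        by (auto simp: v_def)
      have "pform n m z (madd y (emat e m)) v w = pform n m z (madd y (emat e m)) (\<lambda>p. (-1) * u p) w"
        by (rule sform_cong) (auto simp: v_def idx_def)
      also have "\<dots> = - pform n m z (madd y (emat e m)) u w"
        unfolding sform_scale_left by simp
      finally show "2 * Re (pform n m z (madd y (emat e m)) u w) \<le> r * ((vnorm (idx n m) u)\<^sup>2 + (vnorm (idx n m) w)\<^sup>2)"
        using *[rule_format, of v] block[OF y, of v] by (simp add: v1 v2)
    qed (use assms in simp)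
  next
    assume *: "copnorm (idx n m) (mpair ip n m z (madd y (emat e m))) \<le> r"
    show "\<forall>v. 0 \<le> Re (pform (2 * n) m ?b (madd y (emat e m)) v v)"
    proof
      fix v :: "nat \<times> nat \<Rightarrow> complex"
      let ?w = "\<lambda>(i, j). v (n + i, j)"
      let ?a = "vnorm (idx n m) v" and ?b' = "vnorm (idx n m) ?w"
      have "\<bar>Re (pform n m z (madd y (emat e m)) v ?w)\<bar>
          \<le> copnorm (idx n m) (mpair ip n m z (madd y (emat e m))) * ?a * ?b'"
        by (rule order_trans[OF abs_Re_le_cmod sform_le_copnorm]) simp
      also have "\<dots> \<le> r * ?a * ?b'" using * by (intro mult_right_mono) auto
      finally have "2 * \<bar>Re (pform n m z (madd y (emat e m)) v ?w)\<bar> \<le> r * (2 * ?a * ?b')" by simp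
      also have "\<dots> \<le> r * (?a\<^sup>2 + ?b'\<^sup>2)"
        using assms by (intro mult_left_mono sum_squares_bound) simp
      finally show "0 \<le> Re (pform (2 * n) m ?b (madd y (emat e m)) v v)"
        unfolding block[OF y] by linarith
    qed
  qed
  then show ?thesis unfolding Co_iff using herm_block2[OF assms(1)] by blast
qed

section \<open>The order-unit norm and its comparison with the operator Hilbert space norm\<close>

lemma e_norm_upper:
  assumes "y \<in> Bset ip st e m"
  shows "copnorm (idx n m) (mpair ip n m z (madd y (emat e m))) \<le> e_norm ip st e n z"
  unfolding e_norm_def
proof (rule cSup_upper)
  show "bdd_above {copnorm (idx n m) (mpair ip n m z (madd y (emat e m))) | m y. y \<in> Bset ip st e m}"
    by (rule bdd_aboveI[of _ "2 * onorm ip n z"]) (auto intro: copnorm_unit_le)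
qed (use assms in blast)

lemma e_norm_least:
  assumes "\<And>m y. y \<in> Bset ip st e m \<Longrightarrow> copnorm (idx n m) (mpair ip n m z (madd y (emat e m))) \<le> c"
  shows "e_norm ip st e n z \<le> c"
  unfolding e_norm_def by (rule cSup_least) (use assms zero_in_Bset in blast)+

lemma e_norm_nonneg: "0 \<le> e_norm ip st e n z"
  by (rule order_trans[OF copnorm_nonneg e_norm_upper[OF zero_in_Bset]]) simp

text \<open>By the block criterion, the admissible \<open>r\<close> are exactly the positive numbers
  above \<open>e_norm\<close>. If \<open>e_norm\<close> is 0 the infimum is not attained, which is
  why it is approached through \<delta>.\<close>

lemma ou_norm_eq_e_norm:
  assumes z: "in_mat n z"
  shows "ou_norm sm st e (Co ip st e) n z = e_norm ip st e n z"
proof -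
  let ?S = "{r. 0 < r \<and> block2 n (mscale sm r (emat e n)) z (madj st z) (mscale sm r (emat e n)) \<in> Co ip st e (2*n)}"
  have S: "?S = {r. 0 < r \<and> e_norm ip st e n z \<le> r}"
  proof -
    have "(\<forall>m. \<forall>y\<in>Bset ip st e m. copnorm (idx n m) (mpair ip n m z (madd y (emat e m))) \<le> r)
        \<longleftrightarrow> e_norm ip st e n z \<le> r" for r
      by (intro iffI allI ballI) (auto intro: e_norm_least order_trans[OF e_norm_upper])
    then show ?thesis using block2_in_Co_iff[OF z] by auto
  qed
  have "Inf ?S \<le> e_norm ip st e n z + \<delta>" if "\<delta> > 0" for \<delta>
    unfolding S by (rule cInf_lower)
      (use e_norm_nonneg[of n z] that in \<open>auto intro: bdd_belowI[of _ 0]\<close>)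
  then have "Inf ?S \<le> e_norm ip st e n z" by (rule field_le_epsilon)
  moreover have "e_norm ip st e n z \<le> Inf ?S"
    unfolding S
    by (rule cInf_greatest) (use e_norm_nonneg[of n z] in \<open>auto intro: exI[of _ "e_norm ip st e n z + 1"]\<close>)
  ultimately show ?thesis by (simp add: ou_norm_def)
qed

text \<open>A hermitian \<open>h\<close> orthogonal to \<open>e\<close> can be tested against its
  own normalization, giving \<open>|h|\<^sup>2 \<le> |h| G\<close> for the norm
  \<open>onorm\<close>.\<close>

lemma onorm_le_of_pform_Bset:
  assumes h: "herm st n h" "\<And>i j. ip (h i j) e = 0" and "0 \<le> G"
    and *: "\<And>y u v. y \<in> Bset ip st e n \<Longrightarrow>
      cmod (pform n n h y u v) \<le> G * vnorm (idx n n) u * vnorm (idx n n) v"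
  shows "onorm ip n h \<le> G"
proof (cases "onorm ip n h = 0")
  case False
  define s where "s = onorm ip n h"
  have s: "s > 0" using False onorm_nonneg[of n h] by (simp add: s_def)
  have B: "mscale sm (1 / s) h \<in> Bset ip st e n"
    by (rule mscale_in_Bset) (use h s in \<open>auto simp: s_def[symmetric]\<close>)
  have "copnorm (idx n n) (mpair ip n n h h) \<le> s * G"
  proof (rule copnorm_leI)
    fix u v
    have "cmod (pform n n h h u v) = s * cmod (pform n n h (mscale sm (1 / s) h) u v)"
      unfolding pform_mscale_right using s by (simp add: norm_mult norm_divide)
    also have "\<dots> \<le> s * (G * vnorm (idx n n) u * vnorm (idx n n) v)"
      using *[OF B] s by (intro mult_left_mono) auto
    finally show "cmod (pform n n h h u v) \<le> s * G * vnorm (idx n n) u * vnorm (idx n n) v"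
      by (simp add: mult.assoc)
  qed (use s assms in simp)
  then have "s * s \<le> s * G"
    unfolding onorm_power2[symmetric] s_def[symmetric] by (simp add: power2_eq_square)
  then show ?thesis using s by (simp add: s_def)
qed (use assms in simp)

text \<open>Let \<open>a\<close> be the scalar matrix of the \<open>ip (z i j) e\<close>. Pairing
  \<open>z\<close> with \<open>a\<close> times \<open>e\<close> amounts to pairing \<open>z\<close>
  with \<open>e\<close> after replacing \<open>v\<close> by \<open>v' = V a\<^sup>*\<close>, where
  \<open>V\<close> is \<open>v\<close> read as a matrix. The squared norm of \<open>v'\<close> is
  again a value of the pairing of \<open>z\<close> with \<open>e\<close>, at transposed and
  conjugated vectors, so the hypothesis is used twice.\<close>

lemma pform_e_part_le:
  assumes E: "0 \<le> E" and *: "\<And>u v. cmod (pform n n z (emat e n) u v) \<le> E * vnorm (idx n n) u * vnorm (idx n n) v"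
  shows "cmod (pform n n z (\<lambda>i j. sm (ip (z i j) e) e) u v) \<le> E * E * vnorm (idx n n) u * vnorm (idx n n) v"
proof -
  define v' where "v' = (\<lambda>(k, j). \<Sum>l<n. cnj (ip (z j l) e) * v (k, l))"
  define u1 where "u1 = (\<lambda>(j, k). cnj (v' (k, j)))"
  define v1 where "v1 = (\<lambda>(l, k). cnj (v (k, l)))"
  have flip: "vnorm (idx n n) (\<lambda>(j, k). cnj (f (k, j))) = vnorm (idx n n) f" for f
  proof -
    have "(vnorm (idx n n) (\<lambda>(j, k). cnj (f (k, j))))\<^sup>2 = (vnorm (idx n n) f)\<^sup>2"
      unfolding vnorm_idx by (simp, rule sum.swap)
    then show ?thesis by simp
  qed
  have "complex_of_real ((vnorm (idx n n) v')\<^sup>2) = (\<Sum>k<n. \<Sum>j<n. v' (k, j) * cnj (v' (k, j)))"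
    unfolding vnorm_idx by (simp add: complex_norm_square del: of_real_power)
  also have "\<dots> = (\<Sum>k<n. \<Sum>j<n. \<Sum>l<n. cnj (u1 (j, k)) * ip (z j l) e * v1 (l, k))"
    by (intro sum.cong refl) (simp add: u1_def v1_def, simp add: v'_def sum_distrib_left mult.assoc)
  also have "\<dots> = pform n n z (emat e n) u1 v1"
    unfolding pform_emat_right by (rule sum.swap)
  finally have "(vnorm (idx n n) v')\<^sup>2 = cmod (pform n n z (emat e n) u1 v1)"
    by (metis abs_of_nonneg norm_of_real zero_le_power2)
  also have "\<dots> \<le> E * vnorm (idx n n) v' * vnorm (idx n n) v"
    using *[of u1 v1] by (simp add: u1_def v1_def flip)
  finally have "vnorm (idx n n) v' * vnorm (idx n n) v' \<le> vnorm (idx n n) v' * (E * vnorm (idx n n) v)"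
    by (simp add: power2_eq_square mult_ac)
  then have v': "vnorm (idx n n) v' \<le> E * vnorm (idx n n) v"
    using vnorm_nonneg[of "idx n n" v'] E
    by (cases "vnorm (idx n n) v' = 0") (auto simp: mult_le_cancel_left)
  have "pform n n z (\<lambda>i j. sm (ip (z i j) e) e) u v = pform n n z (emat e n) u v'"
    unfolding pform_emat_right unfolding pform_expand
    by (intro sum.cong refl) (simp add: v'_def ip_scale_right sum_distrib_left mult_ac)
  then have "cmod (pform n n z (\<lambda>i j. sm (ip (z i j) e) e) u v) \<le> E * vnorm (idx n n) u * vnorm (idx n n) v'"
    using * by simp
  also have "\<dots> \<le> E * vnorm (idx n n) u * (E * vnorm (idx n n) v)"
    using v' E by (intro mult_left_mono) auto
  finally show ?thesis by (simp add: mult_ac)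
qed

text \<open>Split \<open>z = h + i k + a \<otimes> e\<close> with \<open>h\<close> and \<open>k\<close> hermitian and orthogonal to \<open>e\<close>:
  the three summands are controlled separately.\<close>

lemma onorm_le_units:
  assumes z: "in_mat n z" and E: "0 \<le> E"
    and bound: "\<And>m y. y \<in> Bset ip st e m \<Longrightarrow> copnorm (idx n m) (mpair ip n m z (madd y (emat e m))) \<le> E"
  shows "onorm ip n z \<le> 5 * E"
proof -
  let ?N = "vnorm (idx n n)"
  have unit: "cmod (pform n n z (madd y (emat e n)) u v) \<le> E * ?N u * ?N v" if "y \<in> Bset ip st e n" for y u v
    by (rule order_trans[OF sform_le_copnorm])
      (use bound[OF that] in \<open>auto intro!: mult_right_mono\<close>)
  have e_part: "cmod (pform n n z (emat e n) u v) \<le> E * ?N u * ?N v" for u v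
    using unit[OF zero_in_Bset] by (simp add: madd_zero)
  \<comment> \<open>Removing the shift by \<open>e\<close> costs a second \<open>E\<close>, since
    \<open>e\<close> itself is the unit with \<open>y = 0\<close>.\<close>
  have zB: "cmod (pform n n z y u v) \<le> 2 * E * ?N u * ?N v" if y: "y \<in> Bset ip st e n" for y u v
  proof -
    have "pform n n z y u v = pform n n z (madd y (emat e n)) u v - pform n n z (emat e n) u v"
      by (simp add: pform_madd_right)
    then show ?thesis
      using norm_triangle_ineq4[of "pform n n z (madd y (emat e n)) u v" "pform n n z (emat e n) u v"]
        unit[OF y, of u v] e_part[of u v] by simp
  qed
  define a where "a = (\<lambda>i j. sm (ip (z i j) e) e)"
  define w where "w i j = z i j - a i j" for i j
  have z_eq: "z = madd w a" by (simp add: w_def madd_def)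
  have w_perp: "ip (w i j) e = 0" for i j by (simp add: w_def a_def ip_diff_left ip_scale_left)
  have w_mat: "in_mat n w" using z by (simp add: in_mat_def w_def a_def)
  have wB: "cmod (pform n n w y u v) \<le> 2 * E * ?N u * ?N v" if y: "y \<in> Bset ip st e n" for y u v
  proof -
    have "pform n n a y u v = 0"
      unfolding a_def by (rule pform_perp_left) (use y in \<open>simp add: Bset_iff\<close>)
    then have "pform n n z y u v = pform n n w y u v"
      using arg_cong[OF z_eq, of "\<lambda>t. pform n n t y u v"] unfolding pform_madd_left by simp
    then show ?thesis using zB[OF y, of u v] by simp
  qed
  have part: "onorm ip n (\<lambda>i j. sm c (w i j + sm d (st (w j i)))) \<le> 2 * E"
    if c: "cmod c = 1 / 2" "cmod d = 1" "cnj c = c * d" for c d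
  proof (rule onorm_le_of_pform_Bset)
    let ?h = "\<lambda>i j. sm c (w i j + sm d (st (w j i)))"
    have "d * cnj d = 1" using complex_norm_square[of d] c(2) by simp
    then have cdd: "c * d * cnj d = c" by (simp add: mult.assoc)
    show "herm st n ?h"
      using w_mat by (simp add: herm_iff in_mat_def st_scale st_add c(3) sm_add_right cdd add.commute flip: sm_mult)
    show "ip (?h i j) e = 0" for i j
      by (simp add: ip_scale_left ip_add_left ip_st_e w_perp)
    fix y u v assume y: "y \<in> Bset ip st e n"
    have "pform n n ?h y u v = c * (pform n n w y u v + d * pform n n (madj st w) y u v)"
    proof -
      have "?h = (\<lambda>i j. sm c (madd w (\<lambda>i j. sm d (madj st w i j)) i j))"
        by (simp add: madd_def madj_def)
      then show ?thesis by (simp only: pform_scale_left pform_madd_left)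
    qed
    also have "pform n n (madj st w) y u v = cnj (pform n n w y v u)"
      using y by (intro pform_madj_left herm_madj[of n]) (simp add: Bset_iff)
    finally have "cmod (pform n n ?h y u v) = 1 / 2 * cmod (pform n n w y u v + d * cnj (pform n n w y v u))"
      by (simp only: norm_mult c(1))
    also have "\<dots> \<le> 1 / 2 * (cmod (pform n n w y u v) + cmod (pform n n w y v u))"
      using norm_triangle_ineq[of "pform n n w y u v" "d * cnj (pform n n w y v u)"] c(2)
      by (simp add: norm_mult)
    finally show "cmod (pform n n ?h y u v) \<le> 2 * E * ?N u * ?N v"
      using wB[OF y, of u v] wB[OF y, of v u] by (simp add: mult_ac)
  qed (use E in simp)
  define h where "h i j = sm (1 / 2) (w i j + sm 1 (st (w j i)))" for i j
  define k where "k i j = sm (- \<i> / 2) (w i j + sm (-1) (st (w j i)))" for i j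
  have h: "onorm ip n h \<le> 2 * E" unfolding h_def by (rule part) auto
  have k: "onorm ip n k \<le> 2 * E" unfolding k_def by (rule part) (auto simp: norm_mult norm_divide)
  have "w i j = h i j + sm \<i> (k i j)" for i j
  proof -
    have "h i j + sm \<i> (k i j) = sm (1 / 2) (w i j) + sm (1 / 2) (w i j)"
      by (simp add: h_def k_def sm_add_right sm_minus_left sm_diff_right flip: sm_mult)
    also have "\<dots> = w i j" by (simp flip: sm_add_left)
    finally show ?thesis by simp
  qed
  then have z_split: "z = madd (madd h (\<lambda>i j. sm \<i> (k i j))) a"
    by (intro trans[OF z_eq]) (simp add: madd_def)
  let ?x = "onorm ip n z"
  \<comment> \<open>Only the second slot is split, so one factor \<open>?x\<close> survives:
    \<open>h\<close> and \<open>k\<close> contribute \<open>2 * E\<close> each, and the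
    \<open>e\<close>-component contributes the quadratic term.\<close>
  have "copnorm (idx n n) (mpair ip n n z z) \<le> ?x * (4 * E) + E * E"
  proof (rule copnorm_leI)
    fix u v
    have NN: "0 \<le> ?N u * ?N v" by simp
    have hk: "cmod (pform n n z f u v) \<le> ?x * (2 * E) * (?N u * ?N v)" if "onorm ip n f \<le> 2 * E" for f
    proof -
      have "cmod (pform n n z f u v) \<le> ?x * onorm ip n f * (?N u * ?N v)"
        using pform_le[of n n z f u v] by (simp add: mult.assoc)
      also have "\<dots> \<le> ?x * (2 * E) * (?N u * ?N v)"
        using that by (intro mult_right_mono mult_left_mono NN) (auto simp: onorm_nonneg)
      finally show ?thesis .
    qed
    have "pform n n z z u v = pform n n z h u v + cnj \<i> * pform n n z k u v + pform n n z a u v"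
      using arg_cong[OF z_split, of "\<lambda>t. pform n n z t u v"]
      unfolding pform_madd_right pform_scale_right .
    then have "cmod (pform n n z z u v) \<le> cmod (pform n n z h u v) + cmod (pform n n z k u v) + cmod (pform n n z a u v)"
      using norm_triangle_ineq[of "pform n n z h u v + cnj \<i> * pform n n z k u v" "pform n n z a u v"]
        norm_triangle_ineq[of "pform n n z h u v" "cnj \<i> * pform n n z k u v"]
      by (simp add: norm_mult)
    also have "cmod (pform n n z a u v) \<le> E * E * (?N u * ?N v)"
      using pform_e_part_le[OF E e_part, of u v] by (simp add: a_def mult.assoc)
    finally show "cmod (pform n n z z u v) \<le> (?x * (4 * E) + E * E) * ?N u * ?N v"
      using hk[OF h] hk[OF k] by (simp add: algebra_simps)
  qed (use E onorm_nonneg[of n z] in simp)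
  then have quad: "?x * (?x - 4 * E) \<le> E * E"
    unfolding onorm_power2[symmetric] by (simp add: power2_eq_square algebra_simps)
  show ?thesis
  proof (rule ccontr)
    \<comment> \<open>The quadratic inequality would allow the factor 2 plus the square root of 5.
      With 5 both \<open>?x\<close> and \<open>?x - 4 * E\<close> exceed \<open>E\<close>, which
      contradicts it at once.\<close>
    assume "\<not> ?x \<le> 5 * E"
    then have x: "?x > 5 * E" by simp
    then have "E * E < ?x * (?x - 4 * E)"
      using E by (intro mult_strict_mono'[of E ?x E "?x - 4 * E"]) auto
    with quad show False by simp
  qed
qed

text \<open>If a matrix and its negative lie in the cone, all its pairings with units vanish, and
  the lower norm estimate with \<open>E = 0\<close> forces \<open>onorm\<close> to be 0.\<close>

lemma separated_Co: "separated_cone (Co ip st e)"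
  unfolding separated_cone_def
proof (intro allI equalityI subsetI)
  fix n x assume "x \<in> Co ip st e n \<inter> {x. (\<lambda>i j. - x i j) \<in> Co ip st e n}"
  then have x: "x \<in> Co ip st e n" "(\<lambda>i j. - x i j) \<in> Co ip st e n" by auto
  have mat: "in_mat n x" using Co_herm[OF x(1)] by (simp add: herm_def)
  have "copnorm (idx n m) (mpair ip n m x (madd y (emat e m))) \<le> 0" if y: "y \<in> Bset ip st e m" for m y
  proof (rule copnorm_le_hermitian)
    show "\<bar>Re (pform n m x (madd y (emat e m)) v v)\<bar> \<le> 0 * (vnorm (idx n m) v)\<^sup>2" for v
      using CoD[OF x(1) y, of v] CoD[OF x(2) y, of v] by (simp add: pform_uminus_left)
  qed (use hermitian_mpair[OF herm_madj[OF Co_herm[OF x(1)]] herm_madj[OF herm_unit[OF y]]] in auto)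
  then have "onorm ip n x \<le> 5 * 0" by (intro onorm_le_units mat) auto
  then have on: "onorm ip n x = 0" using onorm_nonneg[of n x] by simp
  have "x i j = 0" for i j
  proof (cases "i < n \<and> j < n")
    case True
    \<comment> \<open>The entry of \<open><<x, x>>\<close> at row \<open>(i, i)\<close> and column
      \<open>(j, j)\<close> is the squared norm of \<open>x i j\<close>.\<close>
    let ?u = "\<lambda>p. if p = (i, i) then 1 else 0 :: complex" and ?v = "\<lambda>p. if p = (j, j) then 1 else 0 :: complex"
    have "pform n n x x ?u ?v = (\<Sum>p\<in>idx n n. if p = (i, i) then
        (\<Sum>q\<in>idx n n. if q = (j, j) then ip (x i j) (x i j) else 0) else 0)"
      unfolding pform_idx by (intro sum.cong refl) (auto intro!: sum.cong simp del: sum.delta sum.delta')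
    also have "\<dots> = ip (x i j) (x i j)" using True by (simp add: idx_def)
    finally have "ip (x i j) (x i j) = 0" using pform_le[of n n x x ?u ?v] on by simp
    then show ?thesis by (rule ip_self_eq_0)
  qed (use mat in \<open>auto simp: in_mat_def\<close>)
  then show "x \<in> {\<lambda>i j. 0}" by auto
qed (auto simp: zero_in_Co)

section \<open>The cone at matrix size one\<close>

lemma pythagoras_e:
  assumes "st p = p"
  defines "p0 \<equiv> p - sm (ip p e) e"
  shows "st p0 = p0" "ip p0 e = 0" "ip p e = complex_of_real (Re (ip p e))"
    "(hnorm ip p)\<^sup>2 = (hnorm ip p0)\<^sup>2 + (Re (ip p e))\<^sup>2" "ip p p0 = complex_of_real ((hnorm ip p0)\<^sup>2)"
proof -
  have "cnj (ip p e) = ip p e" using ip_st_e[of p] assms(1) by simp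
  then show real: "ip p e = complex_of_real (Re (ip p e))" by (simp add: complex_eq_iff)
  show "st p0 = p0"
    unfolding p0_def by (subst (1 2) real) (simp add: st_diff st_scale assms(1))
  show perp: "ip p0 e = 0" by (simp add: p0_def ip_diff_left ip_scale_left)
  have perp': "ip e p0 = 0" using perp cnj_ip[of p0 e] by simp
  have p: "p = p0 + sm (ip p e) e" by (simp add: p0_def)
  have "ip p p0 = ip p0 p0" using ip_add_left[of p0 "sm (ip p e) e" p0] p perp' by (simp add: ip_scale_left)
  then show pp0: "ip p p0 = complex_of_real ((hnorm ip p0)\<^sup>2)" by (simp add: ip_self)
  have "ip p p = ip p p0 + cnj (ip p e) * ip p e"
    using ip_add_right[of p p0 "sm (ip p e) e"] p by (simp add: ip_scale_right)
  then have "complex_of_real ((hnorm ip p)\<^sup>2) = complex_of_real ((hnorm ip p0)\<^sup>2 + (Re (ip p e))\<^sup>2)"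
    unfolding ip_self pp0 by (subst (asm) (1 2) real) (simp add: power2_eq_square)
  then show "(hnorm ip p)\<^sup>2 = (hnorm ip p0)\<^sup>2 + (Re (ip p e))\<^sup>2" unfolding of_real_eq_iff .
qed

definition single :: "'h \<Rightarrow> 'h hmat" where
  "single p = (\<lambda>i j. if i = 0 \<and> j = 0 then p else 0)"

lemma herm_single: "st p = p \<Longrightarrow> herm st 1 (single p)"
  by (auto simp: herm_iff in_mat_def single_def)

lemma onorm_single: "onorm ip 1 (single p) \<le> hnorm ip p"
proof -
  have "copnorm (idx 1 1) (mpair ip 1 1 (single p) (single p)) \<le> (hnorm ip p)\<^sup>2"
  proof (rule copnorm_leI)
    fix u v
    have "vnorm (idx 1 1) f = cmod (f (0, 0))" for f
      by (simp add: vnorm_def idx_def lessThan_Suc)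
    then show "cmod (pform 1 1 (single p) (single p) u v) \<le> (hnorm ip p)\<^sup>2 * vnorm (idx 1 1) u * vnorm (idx 1 1) v"
      unfolding pform_expand by (simp add: single_def ip_self norm_mult norm_power)
  qed simp
  then show ?thesis
    unfolding onorm_power2[symmetric] by (rule power2_le_imp_le) (rule hnorm_nonneg)
qed

text \<open>Write \<open>p = p0 + l e\<close> with \<open>p0\<close> orthogonal to \<open>e\<close>
  and \<open>l\<close> real. Then \<open>|p|\<^sup>2 = |p0|\<^sup>2 + l\<^sup>2\<close>, so the
  square root of 2 in the cone encodes the Lorentz cone condition
  \<open>|p0| \<le> l\<close>.\<close>

lemma unital_cone_iff:
  assumes "st p = p"
  shows "p \<in> unital_cone ip st e \<longleftrightarrow> hnorm ip (p - sm (ip p e) e) \<le> Re (ip p e)"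
proof -
  note py = pythagoras_e[OF assms]
  let ?s = "hnorm ip (p - sm (ip p e) e)" and ?l = "Re (ip p e)"
  have "p \<in> unital_cone ip st e \<longleftrightarrow> hnorm ip p \<le> sqrt 2 * ?l"
    unfolding unital_cone_def
    using arg_cong[OF py(3), of Im] by (simp add: assms less_eq_complex_def)
  also have "\<dots> \<longleftrightarrow> ?s \<le> ?l"
  proof
    assume *: "hnorm ip p \<le> sqrt 2 * ?l"
    then have l: "0 \<le> ?l" using order_trans[OF hnorm_nonneg *] by (simp add: zero_le_mult_iff)
    have "(hnorm ip p)\<^sup>2 \<le> 2 * ?l\<^sup>2"
      using power_mono[OF * hnorm_nonneg, of 2] by (simp add: power_mult_distrib)
    then have "?s\<^sup>2 \<le> ?l\<^sup>2" using py(4) by simp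
    then show "?s \<le> ?l" using l by (rule power2_le_imp_le)
  next
    assume *: "?s \<le> ?l"
    have l: "0 \<le> ?l" using order_trans[OF hnorm_nonneg *] .
    have "?s\<^sup>2 \<le> ?l\<^sup>2" using power_mono[OF * hnorm_nonneg] .
    then have "(hnorm ip p)\<^sup>2 \<le> (sqrt 2 * ?l)\<^sup>2" using py(4) by (simp add: power_mult_distrib)
    then show "hnorm ip p \<le> sqrt 2 * ?l" by (rule power2_le_imp_le) (use l in simp)
  qed
  finally show ?thesis .
qed

lemma Co_1: "{z 0 0 | z. z \<in> Co ip st e 1} = unital_cone ip st e"
proof (intro equalityI subsetI)
  fix p assume "p \<in> {z 0 0 | z. z \<in> Co ip st e 1}"
  then obtain z where z: "z \<in> Co ip st e 1" "p = z 0 0" by blast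
  have stp: "st p = p" using Co_herm[OF z(1)] z(2) by (simp add: herm_iff)
  note py = pythagoras_e[OF stp]
  define p0 where "p0 = p - sm (ip p e) e"
  define s where "s = hnorm ip p0"
  have s0: "s \<ge> 0" by (simp add: s_def hnorm_nonneg)
  \<comment> \<open>The normalized vector \<open>- p0 / s\<close> is the extremal test, with value
    \<open>Re (ip p e) - s\<close>. For \<open>s = 0\<close> the test against \<open>e\<close> alone
    suffices, hence the default 0.\<close>
  define r where "r = (if s = 0 then 0 else - 1 / s)"
  have B: "mscale sm r (single p0) \<in> Bset ip st e 1"
  proof (rule mscale_in_Bset)
    have "\<bar>r\<bar> * onorm ip 1 (single p0) \<le> \<bar>r\<bar> * s"
      unfolding s_def by (intro mult_left_mono onorm_single) simp
    also have "\<dots> \<le> 1" using s0 by (simp add: r_def)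
    finally show "\<bar>r\<bar> * onorm ip 1 (single p0) \<le> 1" .
    show "herm st 1 (single p0)" unfolding p0_def by (rule herm_single[OF py(1)])
    show "ip (single p0 i j) e = 0" for i j using py(2) by (simp add: p0_def single_def)
  qed
  let ?v = "\<lambda>_. 1 :: complex"
  have "pform 1 1 z (madd (mscale sm r (single p0)) (emat e 1)) ?v ?v = complex_of_real r * ip p p0 + ip p e"
    unfolding pform_madd_right pform_mscale_right unfolding pform_expand
    by (simp add: single_def emat_def z(2))
  then have "0 \<le> r * s\<^sup>2 + Re (ip p e)"
    using CoD[OF z(1) B, of ?v] py(5) by (simp add: p0_def[symmetric] s_def[symmetric])
  then have "s \<le> Re (ip p e)" by (simp add: r_def power2_eq_square split: if_splits)
  then show "p \<in> unital_cone ip st e" unfolding unital_cone_iff[OF stp] by (simp add: s_def p0_def)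
next
  fix p assume p: "p \<in> unital_cone ip st e"
  then have stp: "st p = p" by (simp add: unital_cone_def)
  note py = pythagoras_e[OF stp]
  define p0 where "p0 = p - sm (ip p e) e"
  have le: "hnorm ip p0 \<le> Re (ip p e)" using p unital_cone_iff[OF stp] by (simp add: p0_def)
  have split: "single p = madd (single p0) (mscale sm (Re (ip p e)) (emat e 1))"
    using py(3)[symmetric] by (auto simp: single_def madd_def mscale_def emat_def fun_eq_iff p0_def)
  have "single p \<in> Co ip st e 1"
    unfolding Co_iff
  proof (intro conjI allI ballI herm_single stp)
    fix m y v assume y: "y \<in> Bset ip st e m"
    let ?N = "(vnorm (idx 1 m) v)\<^sup>2"
    have "pform 1 m (single p0) (emat e m) v v = 0"
      by (rule pform_perp) (use py(2) in \<open>auto simp: single_def p0_def\<close>)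
    then have eq: "Re (pform 1 m (single p) (madd y (emat e m)) v v)
        = Re (pform 1 m (single p0) y v v) + Re (ip p e) * ?N"
      unfolding split pform_madd_left pform_mscale_left pform_emat_Bset[OF y]
      unfolding pform_madd_right by simp
    have "onorm ip 1 (single p0) * onorm ip m y \<le> hnorm ip p0 * 1"
      using y by (intro mult_mono onorm_single) (auto simp: Bset_iff onorm_nonneg hnorm_nonneg)
    then have "onorm ip 1 (single p0) * onorm ip m y \<le> Re (ip p e)" using le by simp
    then have "onorm ip 1 (single p0) * onorm ip m y * ?N \<le> Re (ip p e) * ?N"
      by (rule mult_right_mono) simp
    moreover have "\<bar>Re (pform 1 m (single p0) y v v)\<bar> \<le> onorm ip 1 (single p0) * onorm ip m y * ?N"
      using order_trans[OF abs_Re_le_cmod pform_le[of 1 m "single p0" y v v]]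
      by (simp add: power2_eq_square mult.assoc)
    ultimately show "0 \<le> Re (pform 1 m (single p) (madd y (emat e m)) v v)"
      unfolding eq by linarith
  qed
  then show "p \<in> {z 0 0 | z. z \<in> Co ip st e 1}"
    by (auto intro!: exI[of _ "single p"] simp: single_def)
qed

end

theorem mainTheorem8:
  fixes sm :: "complex \<Rightarrow> 'h::ab_group_add \<Rightarrow> 'h" and ip :: "'h \<Rightarrow> 'h \<Rightarrow> complex" and st :: "'h \<Rightarrow> 'h" and e :: 'h
  assumes "unital_hilbert_space sm ip st e"
  shows "quantum_cone sm st (Co ip st e) \<and> separated_cone (Co ip st e) \<and> unital_qcone sm st e (Co ip st e)
    \<and> {z 0 0 | z. z \<in> Co ip st e 1} = unital_cone ip st e
    \<and> operator_system sm st e (Co ip st e)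
    \<and> (\<forall>n z. in_mat n z \<longrightarrow> ou_norm sm st e (Co ip st e) n z = e_norm ip st e n z)
    \<and> (\<forall>n z. in_mat n z \<longrightarrow>
         ou_norm sm st e (Co ip st e) n z / 2 \<le> onorm ip n z \<and>
         onorm ip n z \<le> 10 * ou_norm sm st e (Co ip st e) n z)
    \<and> (\<forall>n\<ge>1. {x \<in> polarH ip st (Co ip st e) n. mpair ip 1 n (emat e 1) x = cmat_id (idx 1 n)}
              = {madd y (emat e n) | y. y \<in> Bset ip st e n})
    \<and> polarH ip st (Co ip st e) = Cobar ip st e
    \<and> polarHbar ip st (Cobar ip st e) = Co ip st e"
proof -
  interpret unital_hilbert sm ip st e by (rule unital_hilbert.intro[OF assms])
  have "ou_norm sm st e (Co ip st e) n z / 2 \<le> onorm ip n z \<and>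
      onorm ip n z \<le> 10 * ou_norm sm st e (Co ip st e) n z" if z: "in_mat n z" for n z
  proof -
    have "e_norm ip st e n z \<le> 2 * onorm ip n z"
      by (rule e_norm_least) (rule copnorm_unit_le)
    moreover have "onorm ip n z \<le> 5 * e_norm ip st e n z"
      by (rule onorm_le_units[OF z e_norm_nonneg]) (rule e_norm_upper)
    ultimately show ?thesis
      \<comment> \<open>Nonnegativity of the norm relaxes the factor 5 to the stated 10.\<close>
      using e_norm_nonneg[of n z] by (simp add: ou_norm_eq_e_norm[OF z])
  qed
  moreover have "operator_system sm st e (Co ip st e)"
    by (simp add: operator_system_def quantum_cone_Co separated_Co unital_Co archimedean_Co)
  ultimately show ?thesis
    using quantum_cone_Co separated_Co unital_Co Co_1 ou_norm_eq_e_norm states_Co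
    by (simp add: Cobar_eq_Co polarH_Co polarHbar_Co)
qed

end
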